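(* Let $\{T(t)\}_{t\ge 0}$ be a $C_0$-semigroup (of scalar type spectral operators) on a complex Banach space $X$ generated by a scalar type spectral operator $A$. Then the spectral bound of $A$ equals the growth bound of the semigroup: $s(A)=\omega_0$.
   Context: For a closed linear operator $A$ in a complex Banach space $X$, the resolvent set $\rho(A)$ is the set of $\lambda\in\mathbb{C}$ for which $(A-\lambda I)^{-1}$ exists as a bounded linear operator on $X$, and $\sigma(A)=\mathbb{C}\setminus\rho(A)$ is the spectrum. Scalar type spectral operator: a densely defined closed linear operator $A$ in $X$ for which there is a strongly $\sigma$-additive spectral measure (resolution of the identity) $E_A(\cdot)$, assigning to each Borel subset of $\mathbb{C}$ a bounded projection operator on $X$ (with $E_A(\emptyset)=0$, $E_A(\mathbb{C})=I$, $E_A(\delta\cap\delta')=E_A(\delta)E_A(\delta')$), having $\sigma(A)$ as its support, and such that $A=\int_{\sigma(A)}\lambda\,dE_A(\lambda)$, i.e., $Af=\lim_{n\to\infty}\int_{\{|\lambda|\le n\}}\lambda\,dE_A(\lambda)f$ with domain $D(A)$ consisting of exactly those $f\in X$ for which this limit exists. When a scalar type spectral operator $A$ generates a $C_0$-semigroup, the semigroup is $T(t)=e^{tA}=\int_{\sigma(A)}e^{t\lambda}\,dE_A(\lambda)$, $t\ge 0$, and it consists of scalar type spectral operators. Spectral bound: $s(A):=\sup\{\operatorname{Re}\lambda : \lambda\in\sigma(A)\}$, with $s(A):=-\infty$ if $\sigma(A)=\emptyset$. Growth bound of the semigroup: $\omega_0:=\inf\{\omega\in\mathbb{R} : \exists\,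 M=M(\omega)\ge 1 \text{ such that } \|T(t)\|\le Me^{\omega t} \text{ for all } t\ge 0\}$, where $\|\cdot\|$ on operators is the operator norm. *)

theory Defs
  imports "HOL-Analysis.Analysis"
begin

section \<open>Complex Banach spaces\<close>

text \<open>The norm, topology and real scalar multiplication are those of the underlying real
  normed space, so that the library's real notions (\<^const>\<open>bounded_linear\<close>, \<^const>\<open>onorm\<close>,
  limits) apply; \<open>scaleC_of_real\<close> makes the two scalar multiplications agree.\<close>

class complex_normed_vector = real_normed_vector +
  fixes scaleC :: "complex \<Rightarrow> 'a \<Rightarrow> 'a" (infixr "*\<^sub>C" 75)
  assumes scaleC_of_real: "complex_of_real r *\<^sub>C x = r *\<^sub>R x"
    and scaleC_add_right: "c *\<^sub>C (x + y) = c *\<^sub>C x + c *\<^sub>C y"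
    and scaleC_add_left: "(c + d) *\<^sub>C x = c *\<^sub>C x + d *\<^sub>C x"
    and scaleC_scaleC: "c *\<^sub>C d *\<^sub>C x = (c * d) *\<^sub>C x"
    and norm_scaleC: "norm (c *\<^sub>C x) = cmod c * norm x"

class complex_banach = complex_normed_vector + banach

definition bounded_clinear ::
    "('a::complex_normed_vector \<Rightarrow> 'b::complex_normed_vector) \<Rightarrow> bool" where
  "bounded_clinear f \<longleftrightarrow> bounded_linear f \<and> (\<forall>c x. f (c *\<^sub>C x) = c *\<^sub>C f x)"

section \<open>Unbounded operators\<close>

text \<open>An operator in \<open>X\<close> is given by its domain \<open>D\<close> and a total function \<open>A\<close> of which only
  the values on \<open>D\<close> matter.\<close>

definition linear_operator :: "'a::complex_normed_vector set \<Rightarrow> ('a \<Rightarrow> 'a) \<Rightarrow> bool" where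
  "linear_operator D A \<longleftrightarrow>
     0 \<in> D \<and>
     (\<forall>x\<in>D. \<forall>y\<in>D. x + y \<in> D \<and> A (x + y) = A x + A y) \<and>
     (\<forall>c. \<forall>x\<in>D. c *\<^sub>C x \<in> D \<and> A (c *\<^sub>C x) = c *\<^sub>C A x)"

definition closed_operator :: "'a::complex_normed_vector set \<Rightarrow> ('a \<Rightarrow> 'a) \<Rightarrow> bool" where
  "closed_operator D A \<longleftrightarrow> linear_operator D A \<and> closed {(x, A x) | x. x \<in> D}"

definition densely_defined :: "'a::complex_normed_vector set \<Rightarrow> bool" where
  "densely_defined D \<longleftrightarrow> closure D = UNIV"

definition resolvent_set :: "'a::complex_normed_vector set \<Rightarrow> ('a \<Rightarrow> 'a) \<Rightarrow> complex set" where
  "resolvent_set D A =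
     {z. \<exists>R. bounded_clinear R \<and>
             (\<forall>x. R x \<in> D \<and> A (R x) - z *\<^sub>C R x = x) \<and>
             (\<forall>x\<in>D. R (A x - z *\<^sub>C x) = x)}"

definition spectrum :: "'a::complex_normed_vector set \<Rightarrow> ('a \<Rightarrow> 'a) \<Rightarrow> complex set" where
  "spectrum D A = - resolvent_set D A"

text \<open>Extended real-valued, so that the supremum over an empty spectrum is \<open>-\<infinity>\<close>.\<close>

definition spectral_bound :: "'a::complex_normed_vector set \<Rightarrow> ('a \<Rightarrow> 'a) \<Rightarrow> ereal" where
  "spectral_bound D A = (SUP z\<in>spectrum D A. ereal (Re z))"

section \<open>Scalar type spectral operators\<close>

definition spectral_measure :: "(complex set \<Rightarrow> 'a::complex_normed_vector \<Rightarrow> 'a) \<Rightarrow> bool" where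
  "spectral_measure E \<longleftrightarrow>
     (\<forall>S\<in>sets borel. bounded_clinear (E S) \<and> E S \<circ> E S = E S) \<and>
     E {} = (\<lambda>x. 0) \<and>
     E UNIV = id \<and>
     (\<forall>S\<in>sets borel. \<forall>S'\<in>sets borel. E (S \<inter> S') = E S \<circ> E S') \<and>
     (\<forall>F :: nat \<Rightarrow> complex set. range F \<subseteq> sets borel \<and> disjoint_family F \<longrightarrow>
        (\<forall>x. (\<lambda>n. E (F n) x) sums E (\<Union>n. F n) x))"

definition spectral_support :: "(complex set \<Rightarrow> 'a::complex_normed_vector \<Rightarrow> 'a) \<Rightarrow> complex set" where
  "spectral_support E = \<Inter>{F. closed F \<and> E F = id}"

definition simple_spectral_integral ::
    "(complex set \<Rightarrow> 'a::complex_normed_vector \<Rightarrow> 'a) \<Rightarrow> (complex \<Rightarrow> complex) \<Rightarrow> 'a \<Rightarrow> 'a" where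
  "simple_spectral_integral E s x = (\<Sum>c\<in>range s. c *\<^sub>C E (s -` {c}) x)"

text \<open>The integral \<open>\<integral> g dE\<close> of a bounded Borel function \<open>g\<close>, applied to \<open>x\<close>. Such a \<open>g\<close> is a
  uniform limit of simple functions and a spectral measure is uniformly bounded, so the common
  limit exists and is unique. For unbounded \<open>g\<close> the value is meaningless.\<close>

definition spectral_integral ::
    "(complex set \<Rightarrow> 'a::complex_normed_vector \<Rightarrow> 'a) \<Rightarrow> (complex \<Rightarrow> complex) \<Rightarrow> 'a \<Rightarrow> 'a" where
  "spectral_integral E g x =
     (THE y. \<forall>s. (\<forall>n. simple_function borel (s n)) \<and> uniform_limit UNIV s g sequentially \<longrightarrow>
                 (\<lambda>n. simple_spectral_integral E (s n) x) \<longlonglongrightarrow> y)"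

text \<open>\<open>E\<close> is a resolution of the identity for \<open>A\<close>: the integrals of \<open>z\<close> over the discs
  \<open>\<bar>z\<bar> \<le> n\<close> converge to \<open>A\<close>, and the domain consists of exactly the vectors of convergence.\<close>

definition resolution_of_identity ::
    "(complex set \<Rightarrow> 'a::complex_normed_vector \<Rightarrow> 'a) \<Rightarrow> 'a set \<Rightarrow> ('a \<Rightarrow> 'a) \<Rightarrow> bool" where
  "resolution_of_identity E D A \<longleftrightarrow>
     spectral_measure E \<and>
     spectral_support E = spectrum D A \<and>
     (let J = (\<lambda>n::nat. spectral_integral E (\<lambda>z. if cmod z \<le> real n then z else 0)) in
        D = {x. convergent (\<lambda>n. J n x)} \<and> (\<forall>x\<in>D. (\<lambda>n. J n x) \<longlonglongrightarrow> A x))"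

definition scalar_type_spectral :: "'a::complex_normed_vector set \<Rightarrow> ('a \<Rightarrow> 'a) \<Rightarrow> bool" where
  "scalar_type_spectral D A \<longleftrightarrow>
     closed_operator D A \<and> densely_defined D \<and> (\<exists>E. resolution_of_identity E D A)"

section \<open>Semigroups\<close>

text \<open>A semigroup is a function on the reals of which only the values at \<open>t \<ge> 0\<close> matter.\<close>

definition C0_semigroup :: "(real \<Rightarrow> 'a::complex_normed_vector \<Rightarrow> 'a) \<Rightarrow> bool" where
  "C0_semigroup T \<longleftrightarrow>
     (\<forall>t\<ge>0. bounded_clinear (T t)) \<and>
     T 0 = id \<and>
     (\<forall>s\<ge>0. \<forall>t\<ge>0. T (s + t) = T s \<circ> T t) \<and>
     (\<forall>x. continuous_on {0..} (\<lambda>t. T t x))"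

definition generates ::
    "'a::complex_normed_vector set \<Rightarrow> ('a \<Rightarrow> 'a) \<Rightarrow> (real \<Rightarrow> 'a \<Rightarrow> 'a) \<Rightarrow> bool" where
  "generates D A T \<longleftrightarrow>
     D = {x. \<exists>y. ((\<lambda>h. (T h x - x) /\<^sub>R h) \<longlongrightarrow> y) (at_right 0)} \<and>
     (\<forall>x\<in>D. ((\<lambda>h. (T h x - x) /\<^sub>R h) \<longlongrightarrow> A x) (at_right 0))"

text \<open>Extended real-valued, since the infimum can be \<open>-\<infinity>\<close>.\<close>

definition growth_bound :: "(real \<Rightarrow> 'a::complex_normed_vector \<Rightarrow> 'a) \<Rightarrow> ereal" where
  "growth_bound T =
     Inf (ereal ` {\<omega>. \<exists>M\<ge>1. \<forall>t\<ge>0. onorm (T t) \<le> M * exp (\<omega> * t)})"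

end

theory Submission
  imports Defs
begin

text \<open>
  Write \<open>E\<close> for a resolution of the identity of \<open>A\<close>, \<open>I s\<close> for the integral of a simple function \<open>s\<close>
  with respect to \<open>E\<close>, and \<open>T\<close> for the semigroup. Both inequalities rest on the fact that \<open>E\<close> is
  uniformly bounded (\<open>spectral_measure_bounded\<close>), which makes \<open>I\<close> a bounded multiplicative functional
  calculus. Passing to the equivalent norm \<open>|x| = sup { \<parallel>I s x\<parallel> : |s| \<le> 1 }\<close> (\<open>calculus_norm\<close>)
  improves the bound to \<open>|I s x| \<le> sup |s| \<cdot> |x|\<close>, without a constant.

  Spectral bound \<open>\<le>\<close> growth bound. A point \<open>z\<close> of the spectrum lies in the support of \<open>E\<close>, so no
  ball \<open>B\<close> around \<open>z\<close> has \<open>E B = 0\<close>; on the range of \<open>E B\<close> the operator \<open>A - z\<close> is small, and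
  \<open>z\<close> is an approximate eigenvalue (\<open>spectrum_approximate_eigenvector\<close>). On the other hand, if
  \<open>\<parallel>T t\<parallel> \<le> M exp (\<omega> t)\<close> and \<open>Re z > \<omega>\<close>, then \<open>(Re z - \<omega>) \<parallel>x\<parallel> \<le> M \<parallel>(A - z) x\<parallel>\<close> on the domain
  (\<open>generator_lower_bound\<close>): this is the Hille-Yosida resolvent estimate, obtained from a telescoping
  sum in place of the Laplace transform. The two facts exclude each other, so \<open>Re z \<le> \<omega>\<close>.

  Growth bound \<open>\<le>\<close> spectral bound. Let \<open>Re z \<le> \<sigma>\<close> on the spectrum. If \<open>h > 0\<close> and \<open>h \<sigma> < 1\<close>,
  then \<open>1 / (1 - h z)\<close> is bounded there by \<open>1 / (1 - h \<sigma>)\<close>, hence \<open>(1 - h \<sigma>) |y| \<le> |y - h A y|\<close>: in the new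
  norm \<open>A - \<sigma>\<close> is dissipative (\<open>calculus_norm_dissipative\<close>). Along an orbit, \<open>T u x - h A (T u x)\<close> is
  \<open>T (u - h) x\<close> up to \<open>o(h)\<close>, so one step of length \<open>h\<close> multiplies the new norm by at most
  \<open>1 / (1 - h \<sigma>)\<close>; with \<open>n\<close> steps of length \<open>t / n\<close> this gives \<open>|T t x| \<le> exp (\<sigma> t) |x|\<close>
  (\<open>calculus_norm_semigroup_le\<close>). Absence of a constant in the dissipativity estimate is essential,
  since it would be raised to the \<open>n\<close>-th power.
\<close>

section \<open>Uniform boundedness\<close>

text \<open>By Baire, one of the closed sets on which the whole family is bounded by \<open>n\<close> contains a ball
  \<open>cball a r\<close>; differences of two points of that ball cover all directions, which gives the bound.\<close>
lemma uniform_boundedness: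
  fixes L :: "'i \<Rightarrow> 'a::banach \<Rightarrow> 'b::real_normed_vector"
  assumes lin: "\<And>i. i \<in> I \<Longrightarrow> bounded_linear (L i)"
    and ptw: "\<And>x. \<exists>c. \<forall>i\<in>I. norm (L i x) \<le> c"
  obtains C where "C > 0" "\<And>i x. i \<in> I \<Longrightarrow> norm (L i x) \<le> C * norm x"
proof -
  define S where "S n = {x. \<forall>i\<in>I. norm (L i x) \<le> real n}" for n :: nat
  have closed_S: "closed (S n)" for n
  proof -
    have "S n = (\<Inter>i\<in>I. {x. norm (L i x) \<le> real n})" by (auto simp: S_def)
    moreover have "closed {x. norm (L i x) \<le> real n}" if "i \<in> I" for i
      by (intro closed_Collect_le continuous_intros linear_continuous_on lin that)
    ultimately show ?thesis by auto
  qed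
  have cover: "(\<Union>n. S n) = UNIV"
  proof (intro set_eqI iffI UNIV_I)
    fix x
    obtain c where c: "\<forall>i\<in>I. norm (L i x) \<le> c" using ptw by blast
    obtain n :: nat where "c \<le> real n" using real_arch_simple by blast
    with c have "x \<in> S n" by (auto simp: S_def intro: order_trans)
    then show "x \<in> (\<Union>n. S n)" by blast
  qed
  have "\<exists>n. interior (S n) \<noteq> {}"
  proof (rule ccontr)
    assume "\<not> ?thesis"
    then have "Met_TC.mtopology interior_of \<Union>(range S) = {}"
      by (intro Met_TC.metric_Baire_category_alt) (auto simp: closed_S complete_UNIV)
    with cover show False by simp
  qed
  then obtain n a where "a \<in> interior (S n)" by auto
  then obtain r where r: "r > 0" "cball a r \<subseteq> S n"
    by (meson mem_interior_cball)
  show thesis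
  proof (rule that[of "(2 * real n + 1) / r"])
    show "(2 * real n + 1) / r > 0" using r by simp
    fix i x assume i: "i \<in> I"
    interpret bounded_linear "L i" using lin i .
    show "norm (L i x) \<le> (2 * real n + 1) / r * norm x"
    proof (cases "x = 0")
      case False
      define u where "u = (r / norm x) *\<^sub>R x"
      have "norm u = r" using r False by (simp add: u_def)
      then have "a + u \<in> S n" "a \<in> S n" using r by (auto simp: subset_iff dist_norm)
      then have "norm (L i (a + u)) \<le> real n" "norm (L i a) \<le> real n" using i by (auto simp: S_def)
      then have "norm (L i (a + u) - L i a) \<le> 2 * real n + 1"
        using norm_triangle_ineq4[of "L i (a + u)" "L i a"] by linarith
      then have "norm (L i u) \<le> 2 * real n + 1" by (simp add: add)
      then have "r / norm x * norm (L i x) \<le> 2 * real n + 1"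
        using r by (simp add: u_def scaleR)
      then show ?thesis using r False by (simp add: field_simps)
    qed (simp add: zero)
  qed
qed

section \<open>Linear combinations in complex normed spaces\<close>

lemma bounded_bilinear_scaleC:
  "bounded_bilinear ((*\<^sub>C) :: complex \<Rightarrow> 'a \<Rightarrow> 'a::complex_normed_vector)"
proof
  fix r :: real and c d :: complex and x y :: 'a
  show "(c + d) *\<^sub>C x = c *\<^sub>C x + d *\<^sub>C x" by (rule scaleC_add_left)
  show "c *\<^sub>C (x + y) = c *\<^sub>C x + c *\<^sub>C y" by (rule scaleC_add_right)
  show "(r *\<^sub>R c) *\<^sub>C x = r *\<^sub>R c *\<^sub>C x"
    by (simp add: scaleR_conv_of_real scaleC_scaleC flip: scaleC_of_real)
  show "c *\<^sub>C r *\<^sub>R x = r *\<^sub>R c *\<^sub>C x"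
    by (simp add: scaleC_scaleC mult.commute flip: scaleC_of_real)
  show "\<exists>K. \<forall>(c::complex) x::'a. norm (c *\<^sub>C x) \<le> norm c * norm x * K"
    by (intro exI[of _ 1]) (simp add: norm_scaleC)
qed

interpretation scaleC: bounded_bilinear "(*\<^sub>C) :: complex \<Rightarrow> 'a \<Rightarrow> 'a::complex_normed_vector"
  by (rule bounded_bilinear_scaleC)

lemma scaleC_one [simp]: "1 *\<^sub>C x = (x::'a::complex_normed_vector)"
  using scaleC_of_real[of 1 x] by simp

text \<open>The norm is convex, so as a function of each single coefficient it is maximal at an endpoint \<open>0\<close>
  or \<open>1\<close>. The shift \<open>v\<close> carries the part of the sum that the induction has already treated.\<close>
lemma norm_convex_combination_le:
  fixes v :: "'a::real_normed_vector"
  assumes "finite S" and "\<And>j. j \<in> S \<Longrightarrow> 0 \<le> c j \<and> c j \<le> (1::real)"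
    and "\<And>J. J \<subseteq> S \<Longrightarrow> norm (v + sum y J) \<le> K"
  shows "norm (v + (\<Sum>j\<in>S. c j *\<^sub>R y j)) \<le> K"
  using assms
proof (induction S arbitrary: v)
  case empty
  then show ?case by force
next
  case (insert i S)
  define w where "w = (\<Sum>j\<in>S. c j *\<^sub>R y j)"
  have 0: "norm (v + w) \<le> K"
    unfolding w_def using insert.prems by (intro insert.IH) auto
  have 1: "norm ((v + y i) + w) \<le> K"
    unfolding w_def
  proof (intro insert.IH)
    fix J assume J: "J \<subseteq> S"
    then have "sum y (insert i J) = y i + sum y J"
      using insert.hyps finite_subset[OF J] by (intro sum.insert) auto
    then show "norm (v + y i + sum y J) \<le> K"
      using insert.prems(2)[of "insert i J"] J by (auto simp: add.assoc)
  qed (use insert.prems in auto)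
  have c: "0 \<le> c i" "c i \<le> 1" using insert.prems by auto
  have "v + (\<Sum>j\<in>insert i S. c j *\<^sub>R y j) = (1 - c i) *\<^sub>R (v + w) + c i *\<^sub>R ((v + y i) + w)"
    using insert.hyps by (simp add: w_def algebra_simps)
  also have "norm \<dots> \<le> (1 - c i) * norm (v + w) + c i * norm ((v + y i) + w)"
    using c by (intro norm_triangle_le) simp
  also have "\<dots> \<le> K" by (rule convex_bound_le[OF 0 1]) (use c in auto)
  finally show ?case .
qed

text \<open>Bounds on partial sums control all combinations with coefficients in the unit disc; the factor \<open>4\<close>
  counts the positive and negative parts of the real and imaginary parts of the coefficients.\<close>
lemma norm_complex_combination_le:
  fixes y :: "'i \<Rightarrow> 'a::complex_normed_vector"
  assumes fin: "finite S" and c: "\<And>j. j \<in> S \<Longrightarrow> cmod (c j) \<le> 1"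
    and sub: "\<And>J. J \<subseteq> S \<Longrightarrow> norm (sum y J) \<le> K"
  shows "norm (\<Sum>j\<in>S. c j *\<^sub>C y j) \<le> 4 * K"
proof -
  define P where "P f = (\<Sum>j\<in>S. max 0 (f j) *\<^sub>R y j)" for f :: "'i \<Rightarrow> real"
  have P: "norm (P f) \<le> K" if "\<And>j. j \<in> S \<Longrightarrow> \<bar>f j\<bar> \<le> 1" for f
    unfolding P_def using norm_convex_combination_le[OF fin, of "\<lambda>j. max 0 (f j)" 0 y K] that sub
    by (auto simp: abs_le_iff)
  have eq: "c j *\<^sub>C y j = max 0 (Re (c j)) *\<^sub>R y j - max 0 (- Re (c j)) *\<^sub>R y j
      + \<i> *\<^sub>C (max 0 (Im (c j)) *\<^sub>R y j) - \<i> *\<^sub>C (max 0 (- Im (c j)) *\<^sub>R y j)" for j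
  proof -
    have "c j = complex_of_real (max 0 (Re (c j))) - complex_of_real (max 0 (- Re (c j)))
        + \<i> * complex_of_real (max 0 (Im (c j))) - \<i> * complex_of_real (max 0 (- Im (c j)))"
      by (simp add: complex_eq_iff max_def)
    from arg_cong[OF this, of "\<lambda>d. d *\<^sub>C y j"] show ?thesis
      by (simp only: scaleC.add_left scaleC.diff_left scaleC_scaleC[symmetric] scaleC_of_real)
  qed
  have R: "\<bar>Re (c j)\<bar> \<le> 1" "\<bar>Im (c j)\<bar> \<le> 1" if "j \<in> S" for j
    using c[OF that] abs_Re_le_cmod[of "c j"] abs_Im_le_cmod[of "c j"] by linarith+
  have "(\<Sum>j\<in>S. c j *\<^sub>C y j) = P (\<lambda>j. Re (c j)) - P (\<lambda>j. - Re (c j))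
      + \<i> *\<^sub>C P (\<lambda>j. Im (c j)) - \<i> *\<^sub>C P (\<lambda>j. - Im (c j))"
    unfolding P_def by (subst eq) (simp add: sum.distrib sum_subtractf scaleC.sum_right)
  also have "norm \<dots> \<le> norm (P (\<lambda>j. Re (c j))) + norm (P (\<lambda>j. - Re (c j)))
      + norm (P (\<lambda>j. Im (c j))) + norm (P (\<lambda>j. - Im (c j)))"
    by (rule order_trans[OF norm_triangle_ineq4] add_mono order_trans[OF norm_triangle_ineq]
        | simp add: norm_scaleC)+
  also have "\<dots> \<le> K + K + K + K"
    using R by (intro add_mono P) auto
  finally show ?thesis by simp
qed

section \<open>Spectral measures\<close>

text \<open>With respect to this norm, integration of \<open>s\<close> against \<open>E\<close> has operator norm at most \<open>sup |s|\<close>; for the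
  given norm this holds only up to a constant factor. The two norms are equivalent when \<open>E\<close> is a
  spectral measure.\<close>
definition calculus_norm :: "(complex set \<Rightarrow> 'a::complex_normed_vector \<Rightarrow> 'a) \<Rightarrow> 'a \<Rightarrow> real" where
  "calculus_norm E x =
     (SUP s\<in>{s. simple_function borel s \<and> (\<forall>z. cmod (s z) \<le> 1)}. norm (simple_spectral_integral E s x))"

definition truncation :: "nat \<Rightarrow> complex \<Rightarrow> complex" where
  "truncation n z = (if cmod z \<le> real n then z else 0)"

context
  fixes E :: "complex set \<Rightarrow> 'a::complex_banach \<Rightarrow> 'a"
  assumes E: "spectral_measure E"
begin

lemma spectral_measure_linear: "S \<in> sets borel \<Longrightarrow> bounded_linear (E S)"
  using E by (auto simp: spectral_measure_def bounded_clinear_def)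

lemma spectral_measure_scaleC: "S \<in> sets borel \<Longrightarrow> E S (c *\<^sub>C x) = c *\<^sub>C E S x"
  using E by (auto simp: spectral_measure_def bounded_clinear_def)

lemma spectral_measure_empty: "E {} x = 0"
  using E by (auto simp: spectral_measure_def)

lemma spectral_measure_UNIV: "E UNIV x = x"
  using E by (auto simp: spectral_measure_def)

lemma spectral_measure_Int:
  "S \<in> sets borel \<Longrightarrow> S' \<in> sets borel \<Longrightarrow> E (S \<inter> S') x = E S (E S' x)"
  using E by (auto simp: spectral_measure_def)

lemma spectral_measure_sums:
  "range F \<subseteq> sets borel \<Longrightarrow> disjoint_family F \<Longrightarrow> (\<lambda>n. E (F n) x) sums E (\<Union>n. F n) x"
  for F :: "nat \<Rightarrow> complex set"
  using E by (auto simp: spectral_measure_def)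

lemma spectral_measure_Un:
  assumes "S \<in> sets borel" "S' \<in> sets borel" "S \<inter> S' = {}"
  shows "E (S \<union> S') x = E S x + E S' x"
proof -
  have "(\<lambda>n. E (binaryset S S' n) x) sums E (\<Union>n. binaryset S S' n) x"
    using assms by (intro spectral_measure_sums)
      (auto simp: binaryset_def disjoint_family_on_def split: if_splits)
  moreover have "(\<lambda>n. E (binaryset S S' n) x) sums (\<Sum>n\<in>{0,1}. E (binaryset S S' n) x)"
    by (intro sums_finite) (auto simp: binaryset_def spectral_measure_empty)
  ultimately show ?thesis
    using sums_unique2 by (fastforce simp: UN_binaryset_eq binaryset_def)
qed

lemma spectral_measure_UN:
  assumes "finite J" "\<And>j. j \<in> J \<Longrightarrow> F j \<in> sets borel" "disjoint_family_on F J"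
  shows "E (\<Union>j\<in>J. F j) x = (\<Sum>j\<in>J. E (F j) x)"
  using assms
proof (induction J)
  case (insert i J)
  have "E (F i \<union> (\<Union>j\<in>J. F j)) x = E (F i) x + E (\<Union>j\<in>J. F j) x"
    using insert by (intro spectral_measure_Un) (auto simp: disjoint_family_on_def intro!: sets.finite_UN)
  then show ?case
    using insert by (simp add: disjoint_family_on_def)
qed (simp add: spectral_measure_empty)

lemma spectral_measure_Diff:
  assumes "S \<in> sets borel" "F \<in> sets borel" "S \<subseteq> F"
  shows "E (F - S) x = E F x - E S x"
  using spectral_measure_Un[of S "F - S" x] assms by (simp add: Un_absorb1 sets.Diff)

text \<open>A gliding hump. If \<open>E S x\<close> were unbounded over the Borel subsets \<open>S\<close> of \<open>F\<close>, choose \<open>S\<close> with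
  \<open>E S x\<close> so large that \<open>E (F - S) x\<close> has norm at least \<open>1\<close> as well. The values remain unbounded on one of the two
  halves; discard the other one and repeat. The discarded sets are disjoint, and their values would be the terms
  of a convergent series although their norms are at least \<open>1\<close>.\<close>
lemma spectral_measure_pointwise_bounded: "\<exists>c. \<forall>S\<in>sets borel. norm (E S x) \<le> c"
proof (rule ccontr)
  assume not_bdd: "\<not> ?thesis"
  define unb where "unb F \<longleftrightarrow> F \<in> sets borel \<and> (\<forall>c. \<exists>S\<in>sets borel. S \<subseteq> F \<and> norm (E S x) > c)" for F
  have step: "\<exists>F'. unb F' \<and> F' \<subseteq> F \<and> norm (E (F - F') x) \<ge> 1" if F: "unb F" for F
  proof -
    have Fb: "F \<in> sets borel" using F by (simp add: unb_def)
    obtain S where S: "S \<in> sets borel" "S \<subseteq> F" "norm (E S x) > norm (E F x) + 1"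
      using F unfolding unb_def by blast
    have large: "norm (E (F - S) x) \<ge> 1"
      using S norm_triangle_ineq2[of "E S x" "E F x"]
      by (simp add: spectral_measure_Diff Fb norm_minus_commute)
    have "unb S \<or> unb (F - S)"
    proof (rule ccontr)
      assume "\<not> ?thesis"
      then obtain c c' where c: "\<And>R. R \<in> sets borel \<Longrightarrow> R \<subseteq> S \<Longrightarrow> norm (E R x) \<le> c"
        and c': "\<And>R. R \<in> sets borel \<Longrightarrow> R \<subseteq> F - S \<Longrightarrow> norm (E R x) \<le> c'"
        using S Fb unfolding unb_def by (force simp: not_less)
      have "norm (E R x) \<le> c + c'" if R: "R \<in> sets borel" "R \<subseteq> F" for R
      proof -
        have "R = (R \<inter> S) \<union> (R - S)" by blast
        then have "E R x = E (R \<inter> S) x + E (R - S) x"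
          using spectral_measure_Un[of "R \<inter> S" "R - S" x] R S by auto
        then show ?thesis
          using c[of "R \<inter> S"] c'[of "R - S"] R S
          by (auto intro!: norm_triangle_le add_mono)
      qed
      then show False using F unfolding unb_def by (meson not_less)
    qed
    then show ?thesis
    proof
      assume "unb S"
      then show ?thesis using S large by blast
    next
      assume "unb (F - S)"
      moreover have "F - (F - S) = S" using S by blast
      moreover have "norm (E S x) \<ge> 1" using S(3) norm_ge_zero[of "E F x"] by linarith
      ultimately show ?thesis by (intro exI[of _ "F - S"]) auto
    qed
  qed
  have "unb UNIV" using not_bdd unfolding unb_def by (auto simp: not_le)
  then obtain F where F: "\<And>n. unb (F n)" "\<And>n. F (Suc n) \<subseteq> F n"
      "\<And>n. norm (E (F n - F (Suc n)) x) \<ge> 1"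
    using dependent_nat_choice[of "\<lambda>_. unb" "\<lambda>_ A B. B \<subseteq> A \<and> norm (E (A - B) x) \<ge> 1"] step
    by blast
  have anti: "F n \<subseteq> F m" if "m \<le> n" for m n
    using lift_Suc_antimono_le[of F] F(2) that by blast
  have disj: "disjoint_family (\<lambda>n. F n - F (Suc n))"
  proof -
    have "(F m - F (Suc m)) \<inter> (F n - F (Suc n)) = {}" if "m < n" for m n
      using anti[of "Suc m" n] that by auto
    then show ?thesis
      unfolding disjoint_family_on_def by (metis Int_commute linorder_neqE_nat)
  qed
  have "(\<lambda>n. E (F n - F (Suc n)) x) sums E (\<Union>n. F n - F (Suc n)) x"
    by (intro spectral_measure_sums disj) (use F(1) in \<open>auto simp: unb_def\<close>)
  then have "(\<lambda>n. norm (E (F n - F (Suc n)) x)) \<longlonglongrightarrow> 0"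
    using sums_summable summable_LIMSEQ_zero tendsto_norm_zero by blast
  then have "1 \<le> (0::real)"
    by (rule LIMSEQ_le_const) (use F(3) in auto)
  then show False by simp
qed

lemma spectral_measure_bounded:
  obtains C where "C > 0" "\<And>S x. S \<in> sets borel \<Longrightarrow> norm (E S x) \<le> C * norm x"
  using uniform_boundedness[of "sets borel" E, OF spectral_measure_linear spectral_measure_pointwise_bounded]
  by blast

lemma spectral_measure_support_closed: "closed (spectral_support E)"
  by (auto simp: spectral_support_def)

text \<open>The support is an intersection of arbitrarily many closed sets whose complements are null for \<open>E\<close>;
  by Lindelof's theorem countably many of them suffice, and \<open>\<sigma>\<close>-additivity applies.\<close>
lemma spectral_measure_support: "E (spectral_support E) x = x"
proof -
  define \<U> where "\<U> = uminus ` {F. closed F \<and> E F = id}"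
  obtain \<U>' where \<U>': "\<U>' \<subseteq> \<U>" "countable \<U>'" "\<Union>\<U>' = \<Union>\<U>"
    by (rule Lindelof[of \<U>]) (auto simp: \<U>_def open_Compl)
  have UNIV: "E UNIV = id" using E by (auto simp: spectral_measure_def)
  have un: "\<Union>\<U> = - spectral_support E" by (auto simp: \<U>_def spectral_support_def)
  define U where "U = from_nat_into (insert {} \<U>')"
  have rU: "range U = insert {} \<U>'" unfolding U_def using \<U>'(2) by (intro range_from_nat_into) auto
  have U: "U n \<in> sets borel \<and> (\<forall>y. E (U n) y = 0)" for n
  proof -
    have "U n = {} \<or> U n \<in> \<U>" using rU \<U>'(1) by blast
    then show ?thesis
    proof
      assume "U n \<in> \<U>"
      then obtain F where F: "U n = UNIV - F" "closed F" "E F = id"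
        by (auto simp: \<U>_def)
      then have "E (UNIV - F) y = 0" for y
        by (subst spectral_measure_Diff) (auto simp: spectral_measure_UNIV)
      with F show ?thesis by auto
    qed (auto simp: spectral_measure_empty)
  qed
  have b: "disjointed U n \<in> sets borel" for n
    using sets.range_disjointed_sets[of U borel] U by blast
  have "(\<lambda>n. E (disjointed U n) x) sums E (\<Union>n. disjointed U n) x"
    using b by (intro spectral_measure_sums disjoint_family_disjointed) auto
  moreover have "E (disjointed U n) x = 0" for n
  proof -
    have "disjointed U n = disjointed U n \<inter> U n" using disjointed_subset[of U n] by blast
    then have "E (disjointed U n) x = E (disjointed U n) (E (U n) x)"
      using spectral_measure_Int[OF b, of "U n" n x] U by simp
    also have "\<dots> = 0"
      using U spectral_measure_linear[OF b] by (simp add: linear_simps)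
    finally show ?thesis .
  qed
  ultimately have "E (\<Union>n. U n) x = 0"
    using sums_unique2[OF _ sums_zero] by (simp add: UN_disjointed_eq)
  moreover have "(\<Union>n. U n) = - spectral_support E"
    using rU un \<U>'(3) by auto
  ultimately show ?thesis
    using spectral_measure_Diff[of "- spectral_support E" UNIV x] spectral_measure_support_closed
    by (simp add: Compl_eq_Diff_UNIV double_diff spectral_measure_UNIV)
qed

section \<open>Functional calculus for simple functions\<close>

text \<open>The integral may be computed over any finite measurable partition on which the integrand is constant;
  here the partition is given by the fibres of \<open>p\<close>. Algebraic rules for two simple functions follow
  from the common partition \<open>p z = (s z, s' z)\<close>.\<close>
lemma simple_spectral_integral_refine:
  fixes p :: "complex \<Rightarrow> 'b"
  assumes p: "simple_function borel p" and R: "finite R" "range p \<subseteq> R"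
  shows "simple_spectral_integral E (\<lambda>z. f (p z)) x = (\<Sum>b\<in>R. f b *\<^sub>C E (p -` {b}) x)"
proof -
  have vim: "p -` X \<in> sets borel" for X
    using simple_functionD(2)[OF p, of X] by simp
  have fin: "finite (range p)" using simple_functionD(1)[OF p] by simp
  have fib: "E ((\<lambda>z. f (p z)) -` {c}) x = (\<Sum>b\<in>{b \<in> range p. f b = c}. E (p -` {b}) x)" for c
  proof -
    have "(\<lambda>z. f (p z)) -` {c} = (\<Union>b\<in>{b \<in> range p. f b = c}. p -` {b})" by auto
    then show ?thesis
      using fin vim by (auto simp: disjoint_family_on_def intro!: spectral_measure_UN)
  qed
  have "simple_spectral_integral E (\<lambda>z. f (p z)) x
      = (\<Sum>c\<in>f ` range p. \<Sum>b\<in>{b \<in> range p. f b = c}. f b *\<^sub>C E (p -` {b}) x)"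
    unfolding simple_spectral_integral_def
    by (intro sum.cong) (auto simp: fib scaleC.sum_right image_image)
  also have "\<dots> = (\<Sum>b\<in>range p. f b *\<^sub>C E (p -` {b}) x)"
    using fin by (rule sum.image_gen[symmetric])
  also have "\<dots> = (\<Sum>b\<in>R. f b *\<^sub>C E (p -` {b}) x)"
  proof (intro sum.mono_neutral_left R ballI)
    fix b assume "b \<in> R - range p"
    then have "p -` {b} = {}" by auto
    then show "f b *\<^sub>C E (p -` {b}) x = 0" by (simp add: spectral_measure_empty scaleC.zero_right)
  qed
  finally show ?thesis .
qed

lemma bounded_linear_simple_spectral_integral:
  assumes s: "simple_function borel s"
  shows "bounded_linear (simple_spectral_integral E s)"
proof -
  have "s -` X \<in> sets borel" for X using simple_functionD(2)[OF s, of X] by simp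
  then show ?thesis
    unfolding simple_spectral_integral_def[abs_def]
    by (intro bounded_linear_sum bounded_linear_compose[OF scaleC.bounded_linear_right]
        spectral_measure_linear)
qed

lemma simple_spectral_integral_const [simp]: "simple_spectral_integral E (\<lambda>_. c) x = c *\<^sub>C x"
  by (simp add: simple_spectral_integral_def spectral_measure_UNIV)

lemma simple_spectral_integral_indicator:
  assumes S: "S \<in> sets borel"
  shows "simple_spectral_integral E (indicator S) x = E S x"
proof -
  have p: "simple_function borel (\<lambda>z. z \<in> S)"
    using S by (simp add: simple_function_eq_measurable finite_subset[OF subset_UNIV])
  have "simple_spectral_integral E (\<lambda>z. of_bool (z \<in> S)) x
      = (\<Sum>b\<in>UNIV. of_bool b *\<^sub>C E ((\<lambda>z. z \<in> S) -` {b}) x)"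
    by (rule simple_spectral_integral_refine[OF p]) auto
  also have "\<dots> = E S x"
    by (simp add: UNIV_bool scaleC.zero_left vimage_def)
  finally show ?thesis by (simp add: indicator_def[abs_def])
qed

lemma simple_spectral_integral_diff:
  assumes "simple_function borel s" "simple_function borel s'"
  shows "simple_spectral_integral E (\<lambda>z. s z - s' z) x
      = simple_spectral_integral E s x - simple_spectral_integral E s' x"
proof -
  define p where "p z = (s z, s' z)" for z
  have p: "simple_function borel p" unfolding p_def[abs_def] using assms by simp
  then have fin: "finite (range p)" using simple_functionD(1)[OF p] by simp
  note ref = simple_spectral_integral_refine[OF p fin order.refl]
  show ?thesis
    using ref[of "\<lambda>(c, d). c - d" x] ref[of fst x] ref[of snd x]
    by (simp add: p_def scaleC.diff_left case_prod_unfold sum_subtractf)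
qed

lemma simple_spectral_integral_mult:
  assumes s: "simple_function borel s" and s': "simple_function borel s'"
  shows "simple_spectral_integral E (\<lambda>z. s z * s' z) x
      = simple_spectral_integral E s (simple_spectral_integral E s' x)"
proof -
  define p where "p z = (s z, s' z)" for z
  have p: "simple_function borel p" unfolding p_def[abs_def] using assms by simp
  have fin: "finite (range s)" "finite (range s')"
    using simple_functionD(1)[OF s] simple_functionD(1)[OF s'] by auto
  have vim: "s -` X \<in> sets borel" "s' -` X \<in> sets borel" for X
    using simple_functionD(2)[OF s, of X] simple_functionD(2)[OF s', of X] by auto
  have "simple_spectral_integral E (\<lambda>z. s z * s' z) x
      = (\<Sum>(c, d)\<in>range s \<times> range s'. (c * d) *\<^sub>C E (p -` {(c, d)}) x)"
    using simple_spectral_integral_refine[OF p, of "range s \<times> range s'" "\<lambda>(c, d). c * d" x] fin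
    by (auto simp: p_def case_prod_unfold)
  also have "\<dots> = (\<Sum>c\<in>range s. \<Sum>d\<in>range s'. (c * d) *\<^sub>C E (s -` {c}) (E (s' -` {d}) x))"
  proof -
    have "p -` {(c, d)} = s -` {c} \<inter> s' -` {d}" for c d by (auto simp: p_def)
    then show ?thesis by (simp add: sum.cartesian_product spectral_measure_Int vim)
  qed
  also have "\<dots> = simple_spectral_integral E s (simple_spectral_integral E s' x)"
    unfolding simple_spectral_integral_def
    by (simp add: linear_sum[OF bounded_linear.linear[OF spectral_measure_linear[OF vim(1)]]]
        spectral_measure_scaleC[OF vim(1)] scaleC.sum_right scaleC_scaleC)
  finally show ?thesis .
qed

lemma norm_simple_spectral_integral_le:
  assumes s: "simple_function borel s" "\<And>z. cmod (s z) \<le> 1"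
    and C: "\<And>S x. S \<in> sets borel \<Longrightarrow> norm (E S x) \<le> C * norm x"
  shows "norm (simple_spectral_integral E s x) \<le> 4 * (C * norm x)"
  unfolding simple_spectral_integral_def
proof (rule norm_complex_combination_le)
  show fin: "finite (range s)" using simple_functionD(1)[OF s(1)] by simp
  have vim: "s -` X \<in> sets borel" for X using simple_functionD(2)[OF s(1), of X] by simp
  fix J assume "J \<subseteq> range s"
  then have "finite J" using fin finite_subset by blast
  then have "(\<Sum>c\<in>J. E (s -` {c}) x) = E (\<Union>c\<in>J. s -` {c}) x"
    using vim by (intro spectral_measure_UN[symmetric]) (auto simp: disjoint_family_on_def)
  moreover have "(\<Union>c\<in>J. s -` {c}) = s -` J" by auto
  ultimately show "norm (\<Sum>c\<in>J. E (s -` {c}) x) \<le> C * norm x" using C[OF vim] by simp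
qed (use s in auto)

lemma calculus_norm_bdd_above:
  "bdd_above ((\<lambda>s. norm (simple_spectral_integral E s x)) `
     {s. simple_function borel s \<and> (\<forall>z. cmod (s z) \<le> 1)})"
proof -
  obtain C where "C > 0" "\<And>S x. S \<in> sets borel \<Longrightarrow> norm (E S x) \<le> C * norm x"
    using spectral_measure_bounded by blast
  then show ?thesis
    by (intro bdd_aboveI[of _ "4 * (C * norm x)"]) (auto intro!: norm_simple_spectral_integral_le)
qed

lemma calculus_norm_upper:
  assumes "simple_function borel s" "\<And>z. cmod (s z) \<le> 1"
  shows "norm (simple_spectral_integral E s x) \<le> calculus_norm E x"
  unfolding calculus_norm_def using calculus_norm_bdd_above assms by (intro cSUP_upper) auto

lemma calculus_norm_least:
  assumes "\<And>s. simple_function borel s \<Longrightarrow> (\<And>z. cmod (s z) \<le> 1)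
      \<Longrightarrow> norm (simple_spectral_integral E s x) \<le> b"
  shows "calculus_norm E x \<le> b"
  unfolding calculus_norm_def
proof (rule cSUP_least)
  show "{s :: complex \<Rightarrow> complex. simple_function borel s \<and> (\<forall>z. cmod (s z) \<le> 1)} \<noteq> {}"
    using simple_function_const[of borel 0] by force
qed (use assms in auto)

lemma calculus_norm_bounded:
  obtains K where "K > 0" "\<And>x. calculus_norm E x \<le> K * norm x"
proof -
  obtain C where C: "C > 0" "\<And>S x. S \<in> sets borel \<Longrightarrow> norm (E S x) \<le> C * norm x"
    using spectral_measure_bounded by blast
  have "calculus_norm E x \<le> 4 * C * norm x" for x
    using norm_simple_spectral_integral_le[of _ C x] C(2)
    by (intro calculus_norm_least) (auto simp: mult.assoc)
  then show thesis using C by (intro that[of "4 * C"]) auto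
qed

lemma norm_le_calculus_norm: "norm x \<le> calculus_norm E x"
  using calculus_norm_upper[of "\<lambda>_. 1" x] by simp

lemma calculus_norm_nonneg: "0 \<le> calculus_norm E x"
  using norm_le_calculus_norm[of x] norm_ge_zero[of x] by linarith

lemma calculus_norm_triangle: "calculus_norm E (x + y) \<le> calculus_norm E x + calculus_norm E y"
proof (rule calculus_norm_least)
  fix s :: "complex \<Rightarrow> complex" assume s: "simple_function borel s" "\<And>z. cmod (s z) \<le> 1"
  interpret bounded_linear "simple_spectral_integral E s"
    using s(1) by (rule bounded_linear_simple_spectral_integral)
  show "norm (simple_spectral_integral E s (x + y)) \<le> calculus_norm E x + calculus_norm E y"
    unfolding add using calculus_norm_upper[OF s] by (intro norm_triangle_le add_mono)
qed

lemma tendsto_calculus_norm: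
  assumes "(f \<longlongrightarrow> l) F"
  shows "((\<lambda>i. calculus_norm E (f i)) \<longlongrightarrow> calculus_norm E l) F"
proof -
  obtain K where K: "K > 0" "\<And>x. calculus_norm E x \<le> K * norm x"
    using calculus_norm_bounded by blast
  have le: "calculus_norm E x - calculus_norm E y \<le> K * norm (x - y)" for x y
    using calculus_norm_triangle[of "x - y" y] K(2)[of "x - y"] by simp
  have "((\<lambda>i. calculus_norm E (f i) - calculus_norm E l) \<longlongrightarrow> 0) F"
  proof (rule Lim_null_comparison)
    show "\<forall>\<^sub>F i in F. norm (calculus_norm E (f i) - calculus_norm E l) \<le> K * norm (f i - l)"
    proof (intro always_eventually allI)
      fix i
      show "norm (calculus_norm E (f i) - calculus_norm E l) \<le> K * norm (f i - l)"
        using le[of "f i" l] le[of l "f i"] by (simp add: norm_minus_commute abs_le_iff)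
    qed
    show "((\<lambda>i. K * norm (f i - l)) \<longlongrightarrow> 0) F"
      using assms by (intro tendsto_mult_right_zero tendsto_norm_zero LIM_zero)
  qed
  then show ?thesis by (rule LIM_zero_cancel)
qed

text \<open>Multiplicativity of the calculus makes the integral of \<open>s\<close> a contraction up to the factor \<open>c\<close>:
  if \<open>q\<close> takes values in the unit disc, then so does \<open>q s / c\<close> on \<open>S\<close>. The set \<open>S\<close> localises the bound to the part of
  the spectrum where \<open>x\<close> lives.\<close>
lemma calculus_norm_simple_spectral_integral:
  assumes s: "simple_function borel s" and S: "S \<in> sets borel" "E S x = x"
    and c: "0 \<le> c" "\<And>z. z \<in> S \<Longrightarrow> cmod (s z) \<le> c"
  shows "calculus_norm E (simple_spectral_integral E s x) \<le> c * calculus_norm E x"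
proof (rule calculus_norm_least)
  fix q :: "complex \<Rightarrow> complex" assume q: "simple_function borel q" "\<And>z. cmod (q z) \<le> 1"
  define r where "r z = q z * (s z * indicator S z) / of_real c" for z
  have sS: "simple_function borel (\<lambda>z. s z * indicator S z)" using s S by simp
  have r: "simple_function borel r"
    unfolding r_def[abs_def] by (rule simple_function_div[OF simple_function_mult[OF q(1) sS] simple_function_const])
  have r1: "cmod (r z) \<le> 1" for z
  proof -
    have "cmod (q z) * (cmod (s z) * indicator S z) \<le> 1 * c"
      using q(2)[of z] c by (intro mult_mono) (auto simp: indicator_def)
    then show ?thesis
      using c(1) by (cases "c = 0") (auto simp: r_def norm_mult norm_divide indicator_def)
  qed
  have eq: "(\<lambda>z. of_real c * r z) = (\<lambda>z. q z * (s z * indicator S z))"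
    using c by (cases "c = 0") (auto simp: r_def indicator_def fun_eq_iff)
  have "simple_spectral_integral E q (simple_spectral_integral E s x)
      = simple_spectral_integral E q (simple_spectral_integral E s (E S x))"
    by (simp add: S)
  also have "\<dots> = simple_spectral_integral E (\<lambda>z. q z * (s z * indicator S z)) x"
    using q(1) s S sS
    by (simp add: simple_spectral_integral_mult simple_spectral_integral_indicator del: S(2))
  also have "\<dots> = simple_spectral_integral E (\<lambda>z. of_real c) (simple_spectral_integral E r x)"
    unfolding eq[symmetric] using r by (subst simple_spectral_integral_mult) auto
  also have "norm \<dots> = c * norm (simple_spectral_integral E r x)"
    using c by (simp add: norm_scaleC)
  also have "\<dots> \<le> c * calculus_norm E x"
    using c r r1 by (intro mult_left_mono calculus_norm_upper) auto
  finally show "norm (simple_spectral_integral E q (simple_spectral_integral E s x))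
      \<le> c * calculus_norm E x" .
qed

lemma norm_simple_spectral_integral_diff_le:
  assumes s: "simple_function borel s" "simple_function borel s'"
    and S: "S \<in> sets borel" "E S x = x"
    and c: "0 \<le> c" "\<And>z. z \<in> S \<Longrightarrow> cmod (s z - s' z) \<le> c"
  shows "norm (simple_spectral_integral E s x - simple_spectral_integral E s' x)
      \<le> c * calculus_norm E x"
proof -
  have "norm (simple_spectral_integral E (\<lambda>z. s z - s' z) x) \<le> c * calculus_norm E x"
    using s S c by (intro order_trans[OF norm_le_calculus_norm calculus_norm_simple_spectral_integral]) auto
  then show ?thesis using s by (simp add: simple_spectral_integral_diff)
qed

text \<open>The functional calculus is continuous for uniform convergence, so completeness of the space shows
  that the description in the definition of \<^const>\<open>spectral_integral\<close> does determine a unique vector.\<close>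
lemma spectral_integral_LIMSEQ:
  assumes s: "\<And>n. simple_function borel (s n)" and lim: "uniform_limit UNIV s g sequentially"
  shows "(\<lambda>n. simple_spectral_integral E (s n) x) \<longlonglongrightarrow> spectral_integral E g x"
proof -
  let ?I = "\<lambda>s. simple_spectral_integral E s x"
  have close: "norm (?I q - ?I q') \<le> (a + b) * calculus_norm E x"
    if "simple_function borel q" "simple_function borel q'"
      "\<And>z. cmod (q z - g z) < a" "\<And>z. cmod (q' z - g z) < b" for q q' a b
  proof (rule norm_simple_spectral_integral_diff_le[where S = UNIV])
    fix z
    have *: "cmod (q z - q' z) \<le> cmod (q z - g z) + cmod (q' z - g z)"
      using norm_triangle_ineq4[of "q z - g z" "q' z - g z"] by simp
    then show "cmod (q z - q' z) \<le> a + b" using that(3,4)[of z] by linarith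
    show "0 \<le> a + b" using that(3,4)[of 0] norm_ge_zero[of "q 0 - g 0"] norm_ge_zero[of "q' 0 - g 0"]
      by linarith
  qed (use that in \<open>auto simp: spectral_measure_UNIV\<close>)
  have small: "\<exists>N. \<forall>m\<ge>N. \<forall>n\<ge>N. norm (?I (q m) - ?I (q' n)) < e"
    if e: "e > 0" and q: "\<And>n. simple_function borel (q n)" "uniform_limit UNIV q g sequentially"
      and q': "\<And>n. simple_function borel (q' n)" "uniform_limit UNIV q' g sequentially" for e q q'
  proof -
    define d where "d = e / (2 * (calculus_norm E x + 1))"
    have pos: "calculus_norm E x + 1 > 0" using calculus_norm_nonneg[of x] by linarith
    then have d: "d > 0" using e by (simp add: d_def)
    have dE: "d * (2 * (calculus_norm E x + 1)) = e" using pos by (simp add: d_def)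
    have "\<forall>\<^sub>F n in sequentially. (\<forall>z. cmod (q n z - g z) < d) \<and> (\<forall>z. cmod (q' n z - g z) < d)"
      using uniform_limitD[OF q(2) d] uniform_limitD[OF q'(2) d]
      by eventually_elim (auto simp: dist_norm)
    then obtain N where N: "\<And>n. n \<ge> N \<Longrightarrow> (\<forall>z. cmod (q n z - g z) < d) \<and> (\<forall>z. cmod (q' n z - g z) < d)"
      by (auto simp: eventually_sequentially)
    have "norm (?I (q m) - ?I (q' n)) < e" if "m \<ge> N" "n \<ge> N" for m n
    proof -
      have "norm (?I (q m) - ?I (q' n)) \<le> (d + d) * calculus_norm E x"
        using N[OF that(1)] N[OF that(2)] q q' by (intro close) auto
      also have "\<dots> < (d + d) * (calculus_norm E x + 1)" using d by simp
      also have "\<dots> = e" using dE by (simp add: algebra_simps)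
      finally show ?thesis .
    qed
    then show ?thesis by blast
  qed
  have "Cauchy (\<lambda>n. ?I (s n))"
    unfolding Cauchy_iff using small[OF _ s lim s lim] by blast
  then obtain y where y: "(\<lambda>n. ?I (s n)) \<longlonglongrightarrow> y"
    using Cauchy_convergent_iff convergent_def by blast
  have all: "(\<lambda>n. ?I (q n)) \<longlonglongrightarrow> y"
    if q: "\<And>n. simple_function borel (q n)" "uniform_limit UNIV q g sequentially" for q
  proof -
    have "(\<lambda>n. ?I (q n) - ?I (s n)) \<longlonglongrightarrow> 0"
      unfolding LIMSEQ_iff using small[OF _ q s lim] by (metis diff_zero)
    from tendsto_add[OF this y] show ?thesis by simp
  qed
  have "spectral_integral E g x = y"
    unfolding spectral_integral_def
  proof (rule the_equality)
    fix y' assume "\<forall>s. (\<forall>n. simple_function borel (s n)) \<and> uniform_limit UNIV s g sequentially \<longrightarrow>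
                 (\<lambda>n. ?I (s n)) \<longlonglongrightarrow> y'"
    then have "(\<lambda>n. ?I (s n)) \<longlonglongrightarrow> y'" using s lim by blast
    then show "y' = y" using y LIMSEQ_unique by blast
  qed (use all in auto)
  then show ?thesis using y by simp
qed

section \<open>Integrals of truncated identities\<close>

lemma two_over_Suc_LIMSEQ: "(\<lambda>k. 2 / real (Suc k)) \<longlonglongrightarrow> 0"
  by (rule LIMSEQ_Suc[OF lim_const_over_n])

text \<open>Rounding real and imaginary parts down to multiples of \<open>1 / Suc k\<close> gives simple functions that
  converge uniformly at an explicit rate.\<close>
lemma truncation_approximation:
  obtains s where "\<And>k. simple_function borel (s k)"
    "\<And>k z. cmod (s k z - truncation n z) \<le> 2 / real (Suc k)"
proof -
  define s where "s k z = (if cmod z \<le> real n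
      then Complex (real_of_int \<lfloor>real (Suc k) * Re z\<rfloor> / real (Suc k))
                   (real_of_int \<lfloor>real (Suc k) * Im z\<rfloor> / real (Suc k)) else 0)" for k z
  show thesis
  proof (rule that[of s])
    fix k
    define m where "m = int (Suc k * n)"
    have floor: "\<lfloor>real (Suc k) * a\<rfloor> \<in> {-m..m}" if "\<bar>a\<bar> \<le> real n" for a
    proof -
      have "\<bar>real (Suc k) * a\<bar> \<le> real (Suc k) * real n"
        unfolding abs_mult using that by (intro mult_mono) auto
      then have "\<bar>real (Suc k) * a\<bar> \<le> of_int m" by (simp add: m_def algebra_simps)
      then show ?thesis by (auto simp: abs_le_iff floor_le_iff le_floor_iff)
    qed
    have "range (s k) \<subseteq> insert 0 ((\<lambda>(i, j). Complex (real_of_int i / real (Suc k))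
        (real_of_int j / real (Suc k))) ` ({-m..m} \<times> {-m..m}))"
    proof (intro image_subsetI)
      fix z
      show "s k z \<in> insert 0 ((\<lambda>(i, j). Complex (real_of_int i / real (Suc k))
        (real_of_int j / real (Suc k))) ` ({-m..m} \<times> {-m..m}))"
      proof (cases "cmod z \<le> real n")
        case True
        then have "\<bar>Re z\<bar> \<le> real n" "\<bar>Im z\<bar> \<le> real n"
          using abs_Re_le_cmod[of z] abs_Im_le_cmod[of z] by linarith+
        then have "(\<lfloor>real (Suc k) * Re z\<rfloor>, \<lfloor>real (Suc k) * Im z\<rfloor>) \<in> {-m..m} \<times> {-m..m}"
          using floor by blast
        from imageI[OF this, of "\<lambda>(i, j). Complex (real_of_int i / real (Suc k))
            (real_of_int j / real (Suc k))"] True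
        show ?thesis by (simp add: s_def)
      qed (simp add: s_def)
    qed
    then have "finite (range (s k))" by (rule finite_subset) auto
    moreover have "s k \<in> borel_measurable borel"
      unfolding s_def[abs_def] Complex_eq by measurable
    ultimately show "simple_function borel (s k)"
      by (simp add: simple_function_iff_borel_measurable)
    fix z
    have fl: "\<bar>real_of_int \<lfloor>real (Suc k) * a\<rfloor> / real (Suc k) - a\<bar> \<le> 1 / real (Suc k)" for a
    proof -
      have "real_of_int \<lfloor>real (Suc k) * a\<rfloor> / real (Suc k) - a
          = (real_of_int \<lfloor>real (Suc k) * a\<rfloor> - real (Suc k) * a) / real (Suc k)"
        by (simp add: diff_divide_distrib del: of_nat_Suc)
      moreover have "\<bar>real_of_int \<lfloor>real (Suc k) * a\<rfloor> - real (Suc k) * a\<bar> \<le> 1"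
        by linarith
      ultimately show ?thesis
        by (simp add: abs_divide divide_right_mono del: of_nat_Suc)
    qed
    show "cmod (s k z - truncation n z) \<le> 2 / real (Suc k)"
    proof (cases "cmod z \<le> real n")
      case True
      have "cmod (s k z - truncation n z) \<le> 1 / real (Suc k) + 1 / real (Suc k)"
        using True fl[of "Re z"] fl[of "Im z"]
        by (intro order_trans[OF cmod_le] add_mono) (simp_all add: s_def truncation_def del: of_nat_Suc)
      then show ?thesis by (simp add: add_divide_distrib[symmetric] del: of_nat_Suc)
    qed (simp add: s_def truncation_def)
  qed
qed

lemma spectral_integral_truncation_LIMSEQ:
  assumes s: "\<And>k. simple_function borel (s k)"
    and close: "\<And>k z. cmod (s k z - truncation n z) \<le> 2 / real (Suc k)"
  shows "(\<lambda>k. simple_spectral_integral E (s k) x) \<longlonglongrightarrow> spectral_integral E (truncation n) x"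
proof (rule spectral_integral_LIMSEQ[OF s])
  note lim = two_over_Suc_LIMSEQ
  show "uniform_limit UNIV s (truncation n) sequentially"
  proof (rule uniform_limitI)
    fix e :: real assume "e > 0"
    with lim have "\<forall>\<^sub>F k in sequentially. 2 / real (Suc k) < e"
      by (rule order_tendstoD)
    then show "\<forall>\<^sub>F k in sequentially. \<forall>z\<in>UNIV. dist (s k z) (truncation n z) < e"
      by eventually_elim (use close in \<open>auto simp: dist_norm intro: le_less_trans\<close>)
  qed
qed

lemma norm_spectral_integral_truncation_diff_le:
  assumes q: "simple_function borel q" and S: "S \<in> sets borel" "E S x = x"
    and c: "0 \<le> c" "\<And>z. z \<in> S \<Longrightarrow> cmod (truncation n z - q z) \<le> c"
  shows "norm (spectral_integral E (truncation n) x - simple_spectral_integral E q x)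
      \<le> c * calculus_norm E x"
proof -
  obtain s where s: "\<And>k. simple_function borel (s k)"
    "\<And>k z. cmod (s k z - truncation n z) \<le> 2 / real (Suc k)"
    using truncation_approximation[of n] by blast
  note lim = two_over_Suc_LIMSEQ
  have "norm (spectral_integral E (truncation n) x - simple_spectral_integral E q x)
      \<le> (0 + c) * calculus_norm E x"
  proof (rule LIMSEQ_le)
    show "(\<lambda>k. norm (simple_spectral_integral E (s k) x - simple_spectral_integral E q x)) \<longlonglongrightarrow>
        norm (spectral_integral E (truncation n) x - simple_spectral_integral E q x)"
      by (intro tendsto_intros spectral_integral_truncation_LIMSEQ s)
    show "(\<lambda>k. (2 / real (Suc k) + c) * calculus_norm E x) \<longlonglongrightarrow> (0 + c) * calculus_norm E x"
      by (intro tendsto_intros lim)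
    have "norm (simple_spectral_integral E (s k) x - simple_spectral_integral E q x)
        \<le> (2 / real (Suc k) + c) * calculus_norm E x" for k
    proof (rule norm_simple_spectral_integral_diff_le[OF s(1) q S])
      fix z assume "z \<in> S"
      then show "cmod (s k z - q z) \<le> 2 / real (Suc k) + c"
        using norm_triangle_ineq[of "s k z - truncation n z" "truncation n z - q z"] s(2)[of k z] c(2)[of z]
        by simp
    qed (use c in auto)
    then show "\<exists>N. \<forall>k\<ge>N. norm (simple_spectral_integral E (s k) x - simple_spectral_integral E q x)
        \<le> (2 / real (Suc k) + c) * calculus_norm E x" by blast
  qed
  then show ?thesis by simp
qed

lemma spectral_integral_truncation_cong:
  assumes S: "S \<in> sets borel" "E S x = x"
    and eq: "\<And>z. z \<in> S \<Longrightarrow> truncation n z = truncation m z"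
  shows "spectral_integral E (truncation n) x = spectral_integral E (truncation m) x"
proof -
  obtain s where s: "\<And>k. simple_function borel (s k)"
    "\<And>k z. cmod (s k z - truncation m z) \<le> 2 / real (Suc k)"
    using truncation_approximation[of m] by blast
  note lim = two_over_Suc_LIMSEQ
  have "norm (simple_spectral_integral E (s k) x - spectral_integral E (truncation n) x)
      \<le> 2 / real (Suc k) * calculus_norm E x" for k
    using norm_spectral_integral_truncation_diff_le[OF s(1) S, of "2 / real (Suc k)" n] s(2) eq
    by (metis (full_types) norm_minus_commute of_nat_0_le_iff zero_le_divide_iff zero_le_numeral)
  then have "(\<lambda>k. simple_spectral_integral E (s k) x - spectral_integral E (truncation n) x) \<longlonglongrightarrow> 0"
    by (intro Lim_null_comparison[OF _ tendsto_mult_left_zero[OF lim]] always_eventually allI)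
  then have "(\<lambda>k. simple_spectral_integral E (s k) x) \<longlonglongrightarrow> spectral_integral E (truncation n) x"
    by (rule LIM_zero_cancel)
  with spectral_integral_truncation_LIMSEQ[OF s] show ?thesis
    using LIMSEQ_unique by blast
qed

lemma spectral_measure_incseq_LIMSEQ:
  assumes B: "\<And>n. B n \<in> sets borel" "incseq B"
  shows "(\<lambda>n. E (B n) x) \<longlonglongrightarrow> E (\<Union>n. B n) x"
proof -
  have b: "disjointed B n \<in> sets borel" for n
    using sets.range_disjointed_sets[of B borel] B by blast
  have "(\<lambda>n. E (disjointed B n) x) sums E (\<Union>n. disjointed B n) x"
    using b by (intro spectral_measure_sums disjoint_family_disjointed) auto
  then have "(\<lambda>n. \<Sum>i<Suc n. E (disjointed B i) x) \<longlonglongrightarrow> E (\<Union>n. B n) x"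
    unfolding sums_def UN_disjointed_eq by (rule LIMSEQ_Suc)
  moreover have "(\<Sum>i<Suc n. E (disjointed B i) x) = E (B n) x" for n
  proof -
    have "(\<Sum>i<Suc n. E (disjointed B i) x) = E (\<Union>i<Suc n. disjointed B i) x"
      using b disjoint_family_disjointed[of B]
      by (intro spectral_measure_UN[symmetric]) (auto simp: disjoint_family_on_def)
    also have "(\<Union>i<Suc n. disjointed B i) = B n"
      using finite_UN_disjointed_eq[of B "Suc n"] B(2)
      by (auto simp: lessThan_atLeast0 less_Suc_eq_le dest: incseqD)
    finally show ?thesis .
  qed
  ultimately show ?thesis by simp
qed

section \<open>Operators with a resolution of the identity\<close>

context
  fixes D :: "'a set" and A :: "'a \<Rightarrow> 'a"
  assumes R: "resolution_of_identity E D A"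
begin

lemma resolution_domain: "x \<in> D \<longleftrightarrow> convergent (\<lambda>n. spectral_integral E (truncation n) x)"
  using R unfolding resolution_of_identity_def Let_def truncation_def[abs_def] by blast

lemma resolution_LIMSEQ: "x \<in> D \<Longrightarrow> (\<lambda>n. spectral_integral E (truncation n) x) \<longlonglongrightarrow> A x"
  using R unfolding resolution_of_identity_def Let_def truncation_def[abs_def] by blast

lemma resolution_support: "spectral_support E = spectrum D A"
  using R unfolding resolution_of_identity_def by blast

text \<open>A small ball around \<open>z\<close> carries a nonzero projection; any nonzero vector in its range works, because
  there \<open>A\<close> is the integral of a function that differs from \<open>z\<close> by at most the radius.\<close>
lemma spectrum_approximate_eigenvector:
  assumes z: "z \<in> spectrum D A" and e: "e > 0"
  obtains x where "x \<in> D" "x \<noteq> 0" "norm (A x - z *\<^sub>C x) \<le> e * norm x"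
proof -
  obtain K where K: "K > 0" "\<And>x. calculus_norm E x \<le> K * norm x"
    using calculus_norm_bounded by blast
  define r where "r = e / K"
  have r: "r > 0" using e K by (simp add: r_def)
  have "\<exists>v. E (ball z r) v \<noteq> 0"
  proof (rule ccontr)
    assume "\<not> ?thesis"
    then have "E (UNIV - ball z r) = id"
      by (intro ext) (simp add: spectral_measure_Diff spectral_measure_UNIV)
    moreover have "closed (UNIV - ball z r)" by (intro closed_Diff) auto
    ultimately have "spectral_support E \<subseteq> UNIV - ball z r"
      unfolding spectral_support_def by blast
    then show False using z r resolution_support by auto
  qed
  then obtain v where v: "E (ball z r) v \<noteq> 0" by blast
  define x where "x = E (ball z r) v"
  have S: "ball z r \<in> sets borel" "E (ball z r) x = x"
    using spectral_measure_Int[of "ball z r" "ball z r" v] by (auto simp: x_def)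
  obtain N :: nat where N: "cmod z + r \<le> real N" using real_arch_simple by blast
  have tr: "truncation n w = w" if "w \<in> ball z r" "n \<ge> N" for n w
  proof -
    have "cmod w \<le> cmod z + cmod (w - z)" using norm_triangle_ineq[of z "w - z"] by simp
    also have "\<dots> \<le> real n" using that N by (simp add: dist_norm norm_minus_commute)
    finally show ?thesis by (simp add: truncation_def)
  qed
  have ev: "\<forall>\<^sub>F n in sequentially. spectral_integral E (truncation n) x = spectral_integral E (truncation N) x"
    using eventually_ge_at_top[of N]
    by eventually_elim (rule spectral_integral_truncation_cong[OF S], simp add: tr)
  then have lim: "(\<lambda>n. spectral_integral E (truncation n) x) \<longlonglongrightarrow> spectral_integral E (truncation N) x"
    by (rule tendsto_eventually)
  then have xD: "x \<in> D" by (auto simp: resolution_domain convergent_def)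
  have "A x = spectral_integral E (truncation N) x"
    using LIMSEQ_unique[OF resolution_LIMSEQ[OF xD] lim] .
  then have "norm (A x - z *\<^sub>C x) \<le> r * calculus_norm E x"
    using norm_spectral_integral_truncation_diff_le[of "\<lambda>_. z" "ball z r" x r N] S r
    by (auto simp: tr dist_norm norm_minus_commute)
  also have "\<dots> \<le> r * (K * norm x)" using K r by (intro mult_left_mono) auto
  also have "\<dots> = e * norm x" using K by (simp add: r_def)
  finally show thesis using xD v by (intro that[of x]) (auto simp: x_def)
qed

text \<open>On the support, \<open>1 - h z\<close> has real part at least \<open>1 - h \<sigma>\<close>. If this bound is positive (otherwise
  the claim is trivial), \<open>1 - h z\<close> can be inverted in the functional calculus at the cost of a factor \<open>1 / (1 - h \<sigma>)\<close>. The inversion is done for the simple functions \<open>s k\<close> that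
  approximate the identity on a disc, and then \<open>k\<close> and the radius of the disc tend to infinity.\<close>
lemma calculus_norm_dissipative:
  assumes re: "\<And>z. z \<in> spectrum D A \<Longrightarrow> Re z \<le> \<sigma>" and h: "h > 0" and y: "y \<in> D"
  shows "(1 - h * \<sigma>) * calculus_norm E y \<le> calculus_norm E (y - h *\<^sub>R A y)"
proof -
  define B where "B n = cball 0 (real n) \<inter> spectral_support E" for n :: nat
  have B: "B n \<in> sets borel" for n
    unfolding B_def using spectral_measure_support_closed by (intro borel_closed closed_Int) auto
  have incB: "incseq B" by (auto simp: B_def incseq_def)
  have UNB: "(\<Union>n. B n) = spectral_support E"
    using real_arch_simple by (auto simp: B_def)
  have step: "(1 - h * \<sigma>) * calculus_norm E (E (B n) y)
      \<le> calculus_norm E (y - h *\<^sub>R spectral_integral E (truncation n) y)" for n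
  proof -
    obtain s where s: "\<And>k. simple_function borel (s k)"
      "\<And>k z. cmod (s k z - truncation n z) \<le> 2 / real (Suc k)"
      using truncation_approximation[of n] by blast
    note lim = two_over_Suc_LIMSEQ
    \<comment> \<open>Rounding moves \<open>z\<close> by at most \<open>2 / Suc k\<close>, so that \<open>q k\<close> is a lower bound for \<open>|1 - h s k|\<close> on
      \<open>B n\<close>.\<close>
    define q where "q k = 1 - h * \<sigma> - h * (2 / real (Suc k))" for k
    have "(1 - h * \<sigma> - h * 0) * calculus_norm E (E (B n) y)
        \<le> calculus_norm E (y - h *\<^sub>R spectral_integral E (truncation n) y)"
    proof (rule LIMSEQ_le)
      show "(\<lambda>k. q k * calculus_norm E (E (B n) y)) \<longlonglongrightarrow> (1 - h * \<sigma> - h * 0) * calculus_norm E (E (B n) y)"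
        unfolding q_def by (intro tendsto_intros lim)
      show "(\<lambda>k. calculus_norm E (y - h *\<^sub>R simple_spectral_integral E (s k) y)) \<longlonglongrightarrow>
          calculus_norm E (y - h *\<^sub>R spectral_integral E (truncation n) y)"
        by (intro tendsto_calculus_norm tendsto_intros spectral_integral_truncation_LIMSEQ s)
      have "q k * calculus_norm E (E (B n) y)
          \<le> calculus_norm E (y - h *\<^sub>R simple_spectral_integral E (s k) y)" for k
      proof (cases "q k > 0")
        case False
        then have "q k * calculus_norm E (E (B n) y) \<le> 0"
          using calculus_norm_nonneg by (simp add: mult_nonpos_nonneg)
        then show ?thesis using calculus_norm_nonneg order_trans by blast
      next
        case True
        \<comment> \<open>\<open>r\<close> is the inverse of \<open>d\<close>, which approximates \<open>1 - h z\<close>, cut off outside \<open>B n\<close>, where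
          \<open>d\<close> may vanish.\<close>
        define d where "d z = 1 - of_real h * s k z" for z
        define r where "r z = indicator (B n) z / d z" for z
        have d: "simple_function borel d" unfolding d_def[abs_def]
          using s by (intro simple_function_diff simple_function_mult) auto
        have r: "simple_function borel r" unfolding r_def[abs_def]
          using B d by (intro simple_function_div simple_function_indicator) auto
        have dq: "cmod (d z) \<ge> q k" if "z \<in> B n" for z
        proof -
          have "Re (s k z) \<le> Re (truncation n z) + 2 / real (Suc k)"
            using s(2)[of k z] abs_Re_le_cmod[of "s k z - truncation n z"] by simp
          also have "truncation n z = z" using that by (simp add: B_def truncation_def)
          also have "Re z \<le> \<sigma>" using re that resolution_support by (auto simp: B_def)
          finally have "h * Re (s k z) \<le> h * (\<sigma> + 2 / real (Suc k))" using h by simp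
          then have "q k \<le> Re (d z)" by (simp add: d_def q_def algebra_simps)
          then show ?thesis using complex_Re_le_cmod order_trans by blast
        qed
        have "E (B n) y = simple_spectral_integral E (\<lambda>z. r z * d z) y"
        proof -
          have "r z * d z = indicator (B n) z" for z
            using dq[of z] True by (auto simp: r_def indicator_def)
          then show ?thesis using B by (simp add: simple_spectral_integral_indicator)
        qed
        also have "\<dots> = simple_spectral_integral E r (simple_spectral_integral E d y)"
          using r d by (rule simple_spectral_integral_mult)
        also have "simple_spectral_integral E d y = y - h *\<^sub>R simple_spectral_integral E (s k) y"
          unfolding d_def[abs_def] using s(1)
          by (simp add: simple_spectral_integral_diff simple_spectral_integral_mult scaleC_of_real)
        finally have "E (B n) y = simple_spectral_integral E r (y - h *\<^sub>R simple_spectral_integral E (s k) y)" .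
        moreover have "cmod (r z) \<le> 1 / q k" for z
          using dq[of z] True
          by (auto simp: r_def indicator_def norm_divide intro!: divide_left_mono mult_pos_pos)
        ultimately have "calculus_norm E (E (B n) y)
            \<le> 1 / q k * calculus_norm E (y - h *\<^sub>R simple_spectral_integral E (s k) y)"
          using calculus_norm_simple_spectral_integral[OF r, of UNIV _ "1 / q k"] True
          by (simp add: spectral_measure_UNIV)
        then show ?thesis using True by (simp add: field_simps)
      qed
      then show "\<exists>N. \<forall>k\<ge>N. q k * calculus_norm E (E (B n) y)
          \<le> calculus_norm E (y - h *\<^sub>R simple_spectral_integral E (s k) y)" by blast
    qed
    then show ?thesis by simp
  qed
  have "(\<lambda>n. E (B n) y) \<longlonglongrightarrow> y"
    using spectral_measure_incseq_LIMSEQ[OF B incB, of y] UNB by (simp add: spectral_measure_support)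
  then show ?thesis
    using step resolution_LIMSEQ[OF y]
    by (intro LIMSEQ_le[of "\<lambda>n. (1 - h * \<sigma>) * calculus_norm E (E (B n) y)" _
          "\<lambda>n. calculus_norm E (y - h *\<^sub>R spectral_integral E (truncation n) y)"])
      (auto intro!: tendsto_intros tendsto_calculus_norm)
qed

end

end

section \<open>Semigroups and their generators\<close>

text \<open>Orbits are continuous, hence bounded on \<open>{0..t}\<close>, and uniform boundedness applies.\<close>
lemma C0_semigroup_locally_bounded:
  fixes T :: "real \<Rightarrow> 'a::complex_banach \<Rightarrow> 'a"
  assumes T: "C0_semigroup T"
  obtains Q where "Q > 0" "\<And>u x. 0 \<le> u \<Longrightarrow> u \<le> t \<Longrightarrow> norm (T u x) \<le> Q * norm x"
proof -
  have "\<exists>c. \<forall>u\<in>{0..t}. norm (T u x) \<le> c" for x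
  proof -
    have "continuous_on {0..t} (\<lambda>u. T u x)"
      using T unfolding C0_semigroup_def by (auto intro: continuous_on_subset)
    then have "bounded ((\<lambda>u. T u x) ` {0..t})"
      by (intro compact_imp_bounded compact_continuous_image) auto
    then show ?thesis by (auto simp: bounded_iff)
  qed
  moreover have "bounded_linear (T u)" if "u \<in> {0..t}" for u
    using T that by (auto simp: C0_semigroup_def bounded_clinear_def)
  ultimately show thesis
    using uniform_boundedness[of "{0..t}" T] that by (metis atLeastAtMost_iff)
qed

context
  fixes T :: "real \<Rightarrow> 'a::complex_banach \<Rightarrow> 'a" and D :: "'a set" and A :: "'a \<Rightarrow> 'a"
  assumes T: "C0_semigroup T" and gen: "generates D A T"
begin

lemma semigroup_linear: "t \<ge> 0 \<Longrightarrow> bounded_linear (T t)"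
  using T by (auto simp: C0_semigroup_def bounded_clinear_def)

lemma semigroup_scaleC: "t \<ge> 0 \<Longrightarrow> T t (c *\<^sub>C x) = c *\<^sub>C T t x"
  using T by (auto simp: C0_semigroup_def bounded_clinear_def)

lemma semigroup_zero [simp]: "T 0 x = x"
  using T by (auto simp: C0_semigroup_def)

lemma semigroup_add: "s \<ge> 0 \<Longrightarrow> t \<ge> 0 \<Longrightarrow> T (s + t) x = T s (T t x)"
  using T by (auto simp: C0_semigroup_def)

lemma semigroup_tendsto_zero: "((\<lambda>h. T h x) \<longlongrightarrow> x) (at_right 0)"
proof -
  have "continuous_on {0..} (\<lambda>t. T t x)" using T by (auto simp: C0_semigroup_def)
  then have "((\<lambda>t. T t x) \<longlongrightarrow> T 0 x) (at 0 within {0..})"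
    unfolding continuous_on_def by (rule bspec) simp
  then have "((\<lambda>t. T t x) \<longlongrightarrow> T 0 x) (at_right 0)"
    by (rule tendsto_within_subset) auto
  then show ?thesis by simp
qed

lemma generator_LIM: "x \<in> D \<Longrightarrow> ((\<lambda>h. (T h x - x) /\<^sub>R h) \<longlongrightarrow> A x) (at_right 0)"
  using gen by (auto simp: generates_def)

text \<open>Both facts come from \<open>T h (T u x) - T u x = T u (T h x - x)\<close> and the continuity of \<open>T u\<close>.\<close>
lemma generator_commutes:
  assumes x: "x \<in> D" and u: "u \<ge> 0"
  shows "T u x \<in> D" "A (T u x) = T u (A x)"
proof -
  interpret Tu: bounded_linear "T u" using u by (rule semigroup_linear)
  have "((\<lambda>h. T u ((T h x - x) /\<^sub>R h)) \<longlongrightarrow> T u (A x)) (at_right 0)"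
    using generator_LIM[OF x] by (rule Tu.tendsto)
  moreover have "\<forall>\<^sub>F h in at_right 0. T u ((T h x - x) /\<^sub>R h) = (T h (T u x) - T u x) /\<^sub>R h"
    using eventually_at_right_less[of 0]
  proof eventually_elim
    case (elim h)
    then have "T u (T h x) = T h (T u x)"
      using u semigroup_add[of u h x] semigroup_add[of h u x] by (simp add: add.commute)
    then show ?case by (simp add: Tu.scaleR Tu.diff)
  qed
  ultimately have lim: "((\<lambda>h. (T h (T u x) - T u x) /\<^sub>R h) \<longlongrightarrow> T u (A x)) (at_right 0)"
    by (rule Lim_transform_eventually)
  then show D: "T u x \<in> D" using gen by (auto simp: generates_def)
  show "A (T u x) = T u (A x)"
    using tendsto_unique[OF _ generator_LIM[OF D] lim] by simp
qed

text \<open>The rescaled semigroup \<open>\<phi> t = exp (- z t) T t\<close> has generator \<open>A - z\<close> and decays like \<open>exp (- \<eta> t)\<close> with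
  \<open>\<eta> = Re z - \<omega>\<close>. Summing \<open>\<phi> (k h) (x - \<phi> h x)\<close> over all \<open>k\<close> telescopes to \<open>x\<close>, and a geometric series bounds
  the sum by \<open>M / (1 - exp (- \<eta> h))\<close> times the norm of \<open>x - \<phi> h x\<close>. Dividing by \<open>h\<close> and letting \<open>h\<close> tend to
  \<open>0\<close> yields the claim.\<close>
lemma generator_lower_bound:
  assumes M: "\<And>t x. t \<ge> 0 \<Longrightarrow> norm (T t x) \<le> M * exp (\<omega> * t) * norm x"
    and z: "Re z > \<omega>" and x: "x \<in> D"
  shows "(Re z - \<omega>) * norm x \<le> M * norm (A x - z *\<^sub>C x)"
proof -
  define \<eta> where "\<eta> = Re z - \<omega>"
  have \<eta>: "\<eta> > 0" using z by (simp add: \<eta>_def)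
  define \<phi> where "\<phi> t y = exp (- z * of_real t) *\<^sub>C T t y" for t y
  have norm_\<phi>: "norm (\<phi> t y) \<le> M * exp (- \<eta> * t) * norm y" if t: "t \<ge> 0" for t y
  proof -
    have "norm (\<phi> t y) = exp (- Re z * t) * norm (T t y)"
      by (simp add: \<phi>_def norm_scaleC norm_exp_eq_Re)
    also have "\<dots> \<le> exp (- Re z * t) * (M * exp (\<omega> * t) * norm y)"
      using M[OF t] by (intro mult_left_mono) auto
    also have "\<dots> = M * exp (- \<eta> * t) * norm y"
      by (simp add: \<eta>_def algebra_simps flip: exp_add)
    finally show ?thesis .
  qed
  have \<phi>_zero: "\<phi> 0 y = y" for y by (simp add: \<phi>_def)
  have step: "(1 - exp (- \<eta> * h)) * norm x \<le> M * norm (\<phi> h x - x)" if h: "h > 0" for h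
  proof -
    define r where "r = exp (- \<eta> * h)"
    have r: "0 < r" "r < 1" using \<eta> h by (auto simp: r_def)
    have r_pow: "exp (- \<eta> * (real k * h)) = r ^ k" for k
      by (simp add: r_def algebra_simps flip: exp_of_nat_mult)
    have M0: "M * norm (x - \<phi> h x) \<ge> 0"
      using order_trans[OF norm_ge_zero norm_\<phi>[of 0 "x - \<phi> h x"]] by simp
    have "norm x \<le> M * r ^ n * norm x + M * norm (x - \<phi> h x) / (1 - r)" for n
    proof -
      have diff: "\<phi> (real k * h) x - \<phi> (real (Suc k) * h) x = \<phi> (real k * h) (x - \<phi> h x)" for k
      proof -
        have "T (real (Suc k) * h) x = T (real k * h) (T h x)"
          using semigroup_add[of "real k * h" h x] h by (simp add: algebra_simps)
        moreover have "exp (- z * of_real (real (Suc k) * h)) = exp (- z * of_real (real k * h)) * exp (- z * of_real h)"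
          by (simp add: algebra_simps flip: exp_add)
        moreover have "T (real k * h) (x - c *\<^sub>C y) = T (real k * h) x - c *\<^sub>C T (real k * h) y" for c y
          using h by (simp add: linear_diff[OF bounded_linear.linear[OF semigroup_linear]] semigroup_scaleC)
        ultimately show ?thesis
          by (simp only: \<phi>_def scaleC.diff_right scaleC_scaleC)
      qed
      have "x - \<phi> (real n * h) x = (\<Sum>k<n. \<phi> (real k * h) x - \<phi> (real (Suc k) * h) x)"
        using sum_lessThan_telescope'[of "\<lambda>k. \<phi> (real k * h) x" n] by (simp add: \<phi>_zero)
      also have "\<dots> = (\<Sum>k<n. \<phi> (real k * h) (x - \<phi> h x))" by (simp only: diff)
      also have "norm \<dots> \<le> (\<Sum>k<n. M * norm (x - \<phi> h x) * r ^ k)"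
      proof (rule sum_norm_le)
        fix k
        show "norm (\<phi> (real k * h) (x - \<phi> h x)) \<le> M * norm (x - \<phi> h x) * r ^ k"
          using norm_\<phi>[of "real k * h" "x - \<phi> h x"] h unfolding r_pow by (simp add: mult_ac)
      qed
      also have "\<dots> = M * norm (x - \<phi> h x) * ((1 - r ^ n) / (1 - r))"
        using r by (simp add: sum_gp_strict flip: sum_distrib_left)
      also have "\<dots> \<le> M * norm (x - \<phi> h x) * (1 / (1 - r))"
        using r M0 by (intro mult_left_mono divide_right_mono) auto
      finally have "norm (x - \<phi> (real n * h) x) \<le> M * norm (x - \<phi> h x) / (1 - r)" by simp
      moreover have "norm (\<phi> (real n * h) x) \<le> M * r ^ n * norm x"
        using norm_\<phi>[of "real n * h" x] h by (simp only: r_pow) simp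
      ultimately show ?thesis
        using norm_triangle_ineq[of "\<phi> (real n * h) x" "x - \<phi> (real n * h) x"] by simp
    qed
    moreover have "(\<lambda>n. M * r ^ n * norm x + M * norm (x - \<phi> h x) / (1 - r))
        \<longlonglongrightarrow> M * 0 * norm x + M * norm (x - \<phi> h x) / (1 - r)"
      using r by (intro tendsto_intros LIMSEQ_power_zero) auto
    ultimately have "norm x \<le> M * norm (x - \<phi> h x) / (1 - r)"
      by (intro LIMSEQ_le_const[where X = "\<lambda>n. M * r ^ n * norm x + M * norm (x - \<phi> h x) / (1 - r)"]) auto
    then show ?thesis
      using r by (simp add: pos_le_divide_eq mult.commute norm_minus_commute r_def)
  qed
  have exp_lim: "((\<lambda>h. (exp (- w * of_real h) - 1) / of_real h) \<longlongrightarrow> - w) (at_right 0)" for w :: complex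
  proof -
    have "((\<lambda>c. exp (- w * c)) has_field_derivative - w) (at 0)"
      by (auto intro!: derivative_eq_intros)
    then have "((\<lambda>c. (exp (- w * c) - 1) / c) \<longlongrightarrow> - w) (at 0)"
      by (simp add: DERIV_def)
    moreover have "filterlim complex_of_real (at 0) (at_right 0)"
      by (intro filterlim_atI) (auto intro!: tendsto_eq_intros simp: eventually_at_filter)
    ultimately show ?thesis by (rule filterlim_compose)
  qed
  \<comment> \<open>After division by \<open>h\<close>, both sides of \<open>step\<close> converge as \<open>h\<close> tends to \<open>0\<close> from the right.\<close>
  have "((\<lambda>h. (1 - exp (- \<eta> * h)) / h * norm x) \<longlongrightarrow> \<eta> * norm x) (at_right 0)"
  proof -
    have "((\<lambda>h. exp (- \<eta> * h)) has_field_derivative - \<eta>) (at 0)"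
      by (auto intro!: derivative_eq_intros)
    then have "((\<lambda>h. (exp (- \<eta> * h) - 1) / h) \<longlongrightarrow> - \<eta>) (at 0)"
      by (simp add: DERIV_def)
    then have "((\<lambda>h. (exp (- \<eta> * h) - 1) / h) \<longlongrightarrow> - \<eta>) (at_right 0)"
      by (rule tendsto_within_subset) auto
    then have "((\<lambda>h. - ((exp (- \<eta> * h) - 1) / h) * norm x) \<longlongrightarrow> - (- \<eta>) * norm x) (at_right 0)"
      by (intro tendsto_intros)
    then show ?thesis by (simp add: diff_divide_distrib)
  qed
  moreover have "((\<lambda>h. M * norm ((\<phi> h x - x) /\<^sub>R h)) \<longlongrightarrow> M * norm (A x - z *\<^sub>C x)) (at_right 0)"
  proof -
    have "((\<lambda>h. exp (- z * of_real h) *\<^sub>C ((T h x - x) /\<^sub>R h)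
        + ((exp (- z * of_real h) - 1) / of_real h) *\<^sub>C x) \<longlongrightarrow> exp (- z * of_real 0) *\<^sub>C A x + (- z) *\<^sub>C x) (at_right 0)"
      by (intro tendsto_intros scaleC.tendsto generator_LIM x exp_lim)
    moreover have "exp (- z * of_real h) *\<^sub>C ((T h x - x) /\<^sub>R h)
        + ((exp (- z * of_real h) - 1) / of_real h) *\<^sub>C x = (\<phi> h x - x) /\<^sub>R h" for h
    proof -
      have "c *\<^sub>C a *\<^sub>C (u - x) + ((c - 1) * a) *\<^sub>C x = a *\<^sub>C (c *\<^sub>C u - x)" for c a u
        by (simp add: scaleC.diff_left scaleC.diff_right scaleC_scaleC left_diff_distrib right_diff_distrib mult.commute)
      from this[of "exp (- z * of_real h)" "of_real (inverse h)" "T h x"] show ?thesis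
        unfolding scaleC_of_real by (simp add: \<phi>_def divide_inverse)
    qed
    ultimately show ?thesis
      by (intro tendsto_intros) (simp add: scaleC.minus_left)
  qed
  moreover have "\<forall>\<^sub>F h in at_right 0. (1 - exp (- \<eta> * h)) / h * norm x \<le> M * norm ((\<phi> h x - x) /\<^sub>R h)"
    using eventually_at_right_less[of 0]
  proof eventually_elim
    case (elim h)
    then show ?case
      using divide_right_mono[OF step[of h], of h] by (simp add: divide_inverse mult_ac)
  qed
  ultimately show ?thesis
    unfolding \<eta>_def[symmetric] by (intro tendsto_le[of "at_right 0"]) auto
qed

end

text \<open>A discrete Gronwall estimate: multiplying the recursion by \<open>a ^ k\<close> makes it telescope, and each of
  the \<open>k\<close> errors enters with a weight of at most \<open>B\<close>.\<close>
lemma iterated_contraction_bound: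
  fixes p :: "nat \<Rightarrow> real"
  assumes step: "\<And>k. k < n \<Longrightarrow> a * p (Suc k) \<le> p k + \<delta>"
    and a: "0 \<le> a" "\<And>k. k < n \<Longrightarrow> a ^ k \<le> B" and \<delta>: "0 \<le> \<delta>"
  shows "k \<le> n \<Longrightarrow> a ^ k * p k \<le> p 0 + real k * (B * \<delta>)"
proof (induction k)
  case (Suc k)
  have "a ^ Suc k * p (Suc k) = a ^ k * (a * p (Suc k))" by simp
  also have "\<dots> \<le> a ^ k * (p k + \<delta>)" using step Suc a by (intro mult_left_mono) auto
  also have "\<dots> = a ^ k * p k + a ^ k * \<delta>" by (simp add: distrib_left)
  also have "\<dots> \<le> (p 0 + real k * (B * \<delta>)) + B * \<delta>"
    using Suc a \<delta> by (intro add_mono mult_right_mono) auto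
  finally show ?case by (simp add: algebra_simps)
qed simp

text \<open>The implicit Euler scheme with \<open>n\<close> steps of length \<open>h = t / n\<close>. The vector \<open>w h\<close> is the consistency
  error: \<open>T h x - h A (T h x) = x + h w h\<close>. The \<open>n\<close> errors of size \<open>h w h\<close> add up to a multiple of \<open>w h\<close>,
  which tends to \<open>0\<close>, while \<open>(1 - h \<sigma>)^n\<close> tends to \<open>exp (- \<sigma> t)\<close>.\<close>
lemma calculus_norm_semigroup_le:
  fixes T :: "real \<Rightarrow> 'a::complex_banach \<Rightarrow> 'a"
  assumes T: "C0_semigroup T" and gen: "generates D A T"
    and R: "resolution_of_identity E D A"
    and re: "\<And>z. z \<in> spectrum D A \<Longrightarrow> Re z \<le> \<sigma>" and t: "t > 0" and x: "x \<in> D"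
  shows "calculus_norm E (T t x) \<le> exp (\<sigma> * t) * calculus_norm E x"
proof -
  have E: "spectral_measure E" using R by (simp add: resolution_of_identity_def)
  obtain K where K: "K > 0" "\<And>x. calculus_norm E x \<le> K * norm x"
    using calculus_norm_bounded[OF E] by blast
  obtain Q where Q: "Q > 0" "\<And>u x. 0 \<le> u \<Longrightarrow> u \<le> t \<Longrightarrow> norm (T u x) \<le> Q * norm x"
    using C0_semigroup_locally_bounded[OF T] by blast
  define w where "w h = (T h x - x) /\<^sub>R h - T h (A x)" for h
  define h where "h n = t / real n" for n
  have w_lim: "(\<lambda>n. norm (w (h n))) \<longlonglongrightarrow> 0"
  proof -
    have "filterlim h (at_right 0) sequentially"
      unfolding h_def filterlim_at
      using t by (auto intro!: lim_const_over_n eventually_sequentiallyI[of 1])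
    moreover have "((\<lambda>h. norm (w h)) \<longlongrightarrow> norm (A x - A x)) (at_right 0)"
      unfolding w_def by (intro tendsto_intros generator_LIM[OF T gen x] semigroup_tendsto_zero[OF T gen])
    ultimately show ?thesis by (auto intro: filterlim_compose)
  qed
  \<comment> \<open>A bound for the powers of \<open>1 - h \<sigma>\<close> that is uniform in \<open>n\<close> and valid for both signs of \<open>\<sigma>\<close>.\<close>
  define B where "B = exp (\<bar>\<sigma>\<bar> * t)"
  have main: "(1 + (- \<sigma> * t) / real n) ^ n * calculus_norm E (T t x)
      \<le> calculus_norm E x + t * B * K * Q * norm (w (h n))" if n: "n > 0" "\<sigma> * t < real n" for n
  proof -
    have h: "h n > 0" "real n * h n = t" using t n by (auto simp: h_def)
    define a where "a = 1 - h n * \<sigma>"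
    define \<delta> where "\<delta> = K * (h n * (Q * norm (w (h n))))"
    define p where "p k = calculus_norm E (T (real k * h n) x)" for k
    have a: "0 \<le> a" using n by (simp add: a_def h_def field_simps)
    have a_pow: "a ^ k \<le> B" if "k < n" for k
    proof -
      have "a \<le> 1 + h n * \<bar>\<sigma>\<bar>" using h by (simp add: a_def abs_if mult_nonneg_nonpos mult_nonneg_nonneg)
      also have "\<dots> \<le> exp (h n * \<bar>\<sigma>\<bar>)" by (rule exp_ge_add_one_self)
      finally have "a ^ k \<le> exp (h n * \<bar>\<sigma>\<bar>) ^ k" using a by (intro power_mono) auto
      also have "\<dots> = exp (real k * (h n * \<bar>\<sigma>\<bar>))" by (simp add: exp_of_nat_mult)
      also have "\<dots> \<le> exp (real n * (h n * \<bar>\<sigma>\<bar>))"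
        using h that by (simp add: mult_right_mono)
      also have "real n * (h n * \<bar>\<sigma>\<bar>) = \<bar>\<sigma>\<bar> * t" using h(2) by (simp add: mult.commute mult.left_commute)
      finally show ?thesis by (simp add: B_def)
    qed
    have step: "a * p (Suc k) \<le> p k + \<delta>" if k: "k < n" for k
    proof -
      define u where "u = real k * h n"
      have u: "0 \<le> u" "u \<le> t"
        using h k mult_right_mono[of "real k" "real n" "h n"] by (auto simp: u_def)
      interpret Tu: bounded_linear "T u" using semigroup_linear[OF T gen u(1)] .
      have uh: "real (Suc k) * h n = u + h n" by (simp add: u_def algebra_simps)
      have "a * p (Suc k) \<le> calculus_norm E (T (u + h n) x - h n *\<^sub>R A (T (u + h n) x))"
        unfolding a_def p_def uh using u h generator_commutes(1)[OF T gen x]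
        by (intro calculus_norm_dissipative[OF E R re]) auto
      also have "T (u + h n) x - h n *\<^sub>R A (T (u + h n) x) = T u x + h n *\<^sub>R T u (w (h n))"
      proof -
        have "T (u + h n) x - h n *\<^sub>R A (T (u + h n) x) = T u (T (h n) x - h n *\<^sub>R T (h n) (A x))"
          using u h generator_commutes(2)[OF T gen x, of "u + h n"]
          by (simp add: semigroup_add[OF T gen] Tu.diff Tu.scaleR)
        also have "T (h n) x - h n *\<^sub>R T (h n) (A x) = x + h n *\<^sub>R w (h n)"
          using h by (simp add: w_def algebra_simps)
        finally show ?thesis by (simp add: Tu.add Tu.scaleR)
      qed
      also have "calculus_norm E \<dots> \<le> p k + calculus_norm E (h n *\<^sub>R T u (w (h n)))"
        unfolding p_def u_def[symmetric] by (rule calculus_norm_triangle[OF E])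
      also have "calculus_norm E (h n *\<^sub>R T u (w (h n))) \<le> K * norm (h n *\<^sub>R T u (w (h n)))"
        by (rule K(2))
      also have "\<dots> \<le> \<delta>"
        unfolding \<delta>_def using Q(2)[OF u] K(1) h by (simp add: mult_left_mono)
      finally show ?thesis by simp
    qed
    have "a ^ n * p n \<le> p 0 + real n * (B * \<delta>)"
      using step a a_pow by (rule iterated_contraction_bound) (use K Q h in \<open>auto simp: \<delta>_def\<close>)
    moreover have "real n * (B * \<delta>) = (real n * h n) * B * K * Q * norm (w (h n))"
      by (simp add: \<delta>_def)
    moreover have "a = 1 + (- \<sigma> * t) / real n" by (simp add: a_def h_def)
    ultimately show ?thesis by (simp add: p_def h semigroup_zero[OF T gen])
  qed
  have "exp (- \<sigma> * t) * calculus_norm E (T t x) \<le> calculus_norm E x + t * B * K * Q * 0"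
  proof (rule LIMSEQ_le)
    show "(\<lambda>n. (1 + (- \<sigma> * t) / real n) ^ n * calculus_norm E (T t x)) \<longlonglongrightarrow> exp (- \<sigma> * t) * calculus_norm E (T t x)"
      by (intro tendsto_intros tendsto_exp_limit_sequentially)
    show "(\<lambda>n. calculus_norm E x + t * B * K * Q * norm (w (h n))) \<longlonglongrightarrow> calculus_norm E x + t * B * K * Q * 0"
      by (intro tendsto_intros w_lim)
    obtain N :: nat where "\<sigma> * t < real N" using reals_Archimedean2 by blast
    then show "\<exists>N. \<forall>n\<ge>N. (1 + (- \<sigma> * t) / real n) ^ n * calculus_norm E (T t x)
        \<le> calculus_norm E x + t * B * K * Q * norm (w (h n))"
      by (intro exI[of _ "Suc N"] allI impI main) auto
  qed
  then have "exp (\<sigma> * t) * (exp (- \<sigma> * t) * calculus_norm E (T t x)) \<le> exp (\<sigma> * t) * calculus_norm E x"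
    by (intro mult_left_mono) auto
  then show ?thesis by (simp add: mult.assoc[symmetric] flip: exp_add)
qed

section \<open>Spectral bound and growth bound\<close>

lemma Re_spectrum_le_growth:
  fixes T :: "real \<Rightarrow> 'a::complex_banach \<Rightarrow> 'a"
  assumes T: "C0_semigroup T" and gen: "generates D A T" and R: "resolution_of_identity E D A"
    and M: "\<And>t x. t \<ge> 0 \<Longrightarrow> norm (T t x) \<le> M * exp (\<omega> * t) * norm x" "M > 0"
    and z: "z \<in> spectrum D A"
  shows "Re z \<le> \<omega>"
proof (rule ccontr)
  assume "\<not> ?thesis"
  then have \<eta>: "Re z - \<omega> > 0" by simp
  have E: "spectral_measure E" using R by (simp add: resolution_of_identity_def)
  \<comment> \<open>Half of the smallest value of \<open>e\<close> that \<open>generator_lower_bound\<close> permits.\<close>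
  define e where "e = (Re z - \<omega>) / (2 * M)"
  have e: "e > 0" using \<eta> M(2) by (simp add: e_def)
  obtain x where x: "x \<in> D" "x \<noteq> 0" "norm (A x - z *\<^sub>C x) \<le> e * norm x"
    using spectrum_approximate_eigenvector[OF E R z e] by blast
  have "(Re z - \<omega>) * norm x \<le> M * norm (A x - z *\<^sub>C x)"
    using \<eta> by (intro generator_lower_bound[OF T gen M(1) _ x(1)]) auto
  also have "\<dots> \<le> M * (e * norm x)" using x(3) M(2) by (intro mult_left_mono) auto
  also have "\<dots> = (Re z - \<omega>) * norm x / 2" using M(2) by (simp add: e_def)
  finally show False using \<eta> x(2) mult_pos_pos[of "Re z - \<omega>" "norm x"] by simp
qed

text \<open>The constant \<open>M\<close> is the price for returning to the given norm. The estimate along orbits that start in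
  the domain extends to all vectors by density.\<close>
lemma semigroup_norm_le_spectral:
  fixes T :: "real \<Rightarrow> 'a::complex_banach \<Rightarrow> 'a"
  assumes T: "C0_semigroup T" and gen: "generates D A T" and R: "resolution_of_identity E D A"
    and dense: "densely_defined D"
    and re: "\<And>z. z \<in> spectrum D A \<Longrightarrow> Re z \<le> \<sigma>"
  obtains M where "M \<ge> 1" "\<And>t x. t \<ge> 0 \<Longrightarrow> norm (T t x) \<le> M * exp (\<sigma> * t) * norm x"
proof -
  have E: "spectral_measure E" using R by (simp add: resolution_of_identity_def)
  obtain K where K: "K > 0" "\<And>x. calculus_norm E x \<le> K * norm x"
    using calculus_norm_bounded[OF E] by blast
  define M where "M = max 1 K"
  have M: "M \<ge> 1" "calculus_norm E x \<le> M * norm x" for x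
    using K(2)[of x] mult_right_mono[of K M "norm x"] by (auto simp: M_def)
  have "norm (T t x) \<le> M * exp (\<sigma> * t) * norm x" if t: "t \<ge> 0" for t x
  proof -
    have on_D: "norm (T t x) \<le> M * exp (\<sigma> * t) * norm x" if x: "x \<in> D" for x
    proof (cases "t = 0")
      case True
      then show ?thesis using norm_le_calculus_norm[OF E, of x] M(2)[of x] semigroup_zero[OF T gen] by simp
    next
      case False
      have "norm (T t x) \<le> exp (\<sigma> * t) * calculus_norm E x"
        using calculus_norm_semigroup_le[OF T gen R re _ x, of t] False t
          norm_le_calculus_norm[OF E, of "T t x"] by simp
      also have "\<dots> \<le> exp (\<sigma> * t) * (M * norm x)" using M by (intro mult_left_mono) auto
      finally show ?thesis by (simp add: mult_ac)
    qed
    have "closed {x. norm (T t x) \<le> M * exp (\<sigma> * t) * norm x}"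
      by (intro closed_Collect_le continuous_intros linear_continuous_on semigroup_linear[OF T gen t])
    then have "closure D \<subseteq> {x. norm (T t x) \<le> M * exp (\<sigma> * t) * norm x}"
      using on_D by (intro closure_minimal) auto
    then show ?thesis using dense by (auto simp: densely_defined_def)
  qed
  with M(1) show thesis by (rule that)
qed

theorem corollary3p1:
  fixes T :: "real \<Rightarrow> 'a::complex_banach \<Rightarrow> 'a"
    and D :: "'a set" and A :: "'a \<Rightarrow> 'a"
  assumes "C0_semigroup T"
    and "generates D A T"
    and "scalar_type_spectral D A"
  shows "spectral_bound D A = growth_bound T"
proof (rule antisym)
  obtain E where E: "resolution_of_identity E D A" "densely_defined D"
    using assms(3) by (auto simp: scalar_type_spectral_def)
  have lin: "bounded_linear (T t)" if "t \<ge> 0" for t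
    using semigroup_linear[OF assms(1,2) that] .
  show "spectral_bound D A \<le> growth_bound T"
    unfolding spectral_bound_def growth_bound_def
  proof (intro SUP_least INF_greatest)
    fix z \<omega>
    assume z: "z \<in> spectrum D A" and "\<omega> \<in> {\<omega>. \<exists>M\<ge>1. \<forall>t\<ge>0. onorm (T t) \<le> M * exp (\<omega> * t)}"
    then obtain M where M: "M \<ge> 1" "\<And>t. t \<ge> 0 \<Longrightarrow> onorm (T t) \<le> M * exp (\<omega> * t)" by blast
    have "norm (T t x) \<le> M * exp (\<omega> * t) * norm x" if "t \<ge> 0" for t x
      using onorm[OF lin[OF that], of x] mult_right_mono[OF M(2)[OF that] norm_ge_zero[of x]] by linarith
    then show "ereal (Re z) \<le> ereal \<omega>"
      using Re_spectrum_le_growth[OF assms(1,2) E(1) _ _ z, of M \<omega>] M(1) by simp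
  qed
  show "growth_bound T \<le> spectral_bound D A"
  proof (rule ereal_le_real)
    fix \<sigma> assume "spectral_bound D A \<le> ereal \<sigma>"
    then have "Re z \<le> \<sigma>" if "z \<in> spectrum D A" for z
      using that by (auto simp: spectral_bound_def SUP_le_iff)
    then obtain M where M: "M \<ge> 1" "\<And>t x. t \<ge> 0 \<Longrightarrow> norm (T t x) \<le> M * exp (\<sigma> * t) * norm x"
      using semigroup_norm_le_spectral[OF assms(1,2) E] by blast
    have "onorm (T t) \<le> M * exp (\<sigma> * t)" if "t \<ge> 0" for t
      using M that by (intro onorm_bound) auto
    then show "growth_bound T \<le> ereal \<sigma>"
      unfolding growth_bound_def using M(1) by (intro INF_lower) auto
  qed
qed

end
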